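(* Let $N\ge 3$, let $v\in C_0^\infty(\mathbb{R}^N)$ be any function, $v\not\equiv 0$, and let $$u(x)=|x|^{-\frac{N-2}{2}}\,J_0(|x|)\,v(x).$$ Then $$\int_{\mathbb{R}^N}|\nabla u|^2\,dx-\Big(\frac{N-2}{2}\Big)^2\int_{\mathbb{R}^N}\frac{u^2}{|x|^2}\,dx\;>\;\int_{\mathbb{R}^N}u^2\,dx .$$ The best constant in this inequality (the largest constant $C$ such that the inequality with right-hand side $C\int_{\mathbb{R}^N}u^2\,dx$ holds for all such $u$) is $1$, and there exists no minimizer.
   Context: $J_0$ is the Bessel function of the first kind of order $0$, normalized by $J_0(0)=1$. The left-hand side (the Hardy functional on $\mathbb{R}^N$) is understood as a principal value at the origin when both integrals diverge: it is $\lim_{\varepsilon\to0}\Big(\int_{\{|x|>\varepsilon\}}|\nabla u|^2\,dx-\big(\tfrac{N-2}{2}\big)^2\int_{\{|x|>\varepsilon\}}\frac{u^2}{|x|^2}\,dx\Big)$. "Minimizer" refers to the quotient of the left-hand side by $\int_{\mathbb{R}^N}u^2\,dx$ over the functions $u$ of the form $u(x)=|x|^{-\frac{N-2}{2}}\,J_0(|x|)\,v(x)$ with $v\in C_0^\infty(\mathbb{R}^N)$, $v\not\equiv0$. *)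

theory Defs
  imports "HOL-Analysis.Analysis"
begin

text \<open>The Bessel function \<open>J\<^sub>0\<close> of the first kind, by its power series; the constant term
  gives \<open>J\<^sub>0(0) = 1\<close>.\<close>

definition bessel_J0 :: "real \<Rightarrow> real" where
  "bessel_J0 t = (\<Sum>k. (-1) ^ k / (fact k)\<^sup>2 * (t / 2) ^ (2 * k))"

fun times_cont_diff :: "nat \<Rightarrow> ('a::real_normed_vector \<Rightarrow> real) \<Rightarrow> bool" where
  "times_cont_diff 0 f \<longleftrightarrow> continuous_on UNIV f"
| "times_cont_diff (Suc k) f \<longleftrightarrow>
     (\<forall>x. f differentiable (at x)) \<and>
     (\<forall>h. times_cont_diff k (\<lambda>x. frechet_derivative f (at x) h))"

definition test_functions :: "('a::real_normed_vector \<Rightarrow> real) set" where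
  "test_functions = {v. (\<forall>k. times_cont_diff k v) \<and> compact (closure {x. v x \<noteq> 0})}"

definition grad :: "('a::real_inner \<Rightarrow> real) \<Rightarrow> 'a \<Rightarrow> 'a" where
  "grad f x = (THE D. GDERIV f x :> D)"

definition hardy_const :: "'n::finite itself \<Rightarrow> real" where
  "hardy_const _ = ((real CARD('n) - 2) / 2)\<^sup>2"

definition hardy_truncated :: "(real ^ 'n \<Rightarrow> real) \<Rightarrow> real \<Rightarrow> real" where
  "hardy_truncated u \<epsilon> =
     (LINT x:{x. norm x > \<epsilon>}|lborel. (norm (grad u x))\<^sup>2)
     - hardy_const TYPE('n) * (LINT x:{x. norm x > \<epsilon>}|lborel. (u x)\<^sup>2 / (norm x)\<^sup>2)"

text \<open>\<open>has_hardy_value u L\<close>: the Hardy functional of \<open>u\<close> is well defined, with value \<open>L\<close>.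
  It is the plain difference of two convergent integrals, or, when both integrals diverge, the
  principal value at the origin. If exactly one of the integrals diverges there is no value.
  The integrability clauses are needed because the Bochner integral of a non-integrable function
  is \<open>0\<close>. The values of \<open>u\<close> and \<open>grad u\<close> at the origin, where \<open>u\<close> may be singular, do not matter
  since a point is a null set.\<close>

definition has_hardy_value :: "(real ^ 'n \<Rightarrow> real) \<Rightarrow> real \<Rightarrow> bool" where
  "has_hardy_value u L \<longleftrightarrow>
     (if integrable lborel (\<lambda>x. (norm (grad u x))\<^sup>2)
       \<or> integrable lborel (\<lambda>x. (u x)\<^sup>2 / (norm x)\<^sup>2)
      then integrable lborel (\<lambda>x. (norm (grad u x))\<^sup>2)
         \<and> integrable lborel (\<lambda>x. (u x)\<^sup>2 / (norm x)\<^sup>2)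
         \<and> L = (LINT x|lborel. (norm (grad u x))\<^sup>2)
               - hardy_const TYPE('n) * (LINT x|lborel. (u x)\<^sup>2 / (norm x)\<^sup>2)
      else (\<forall>\<epsilon>>0. set_integrable lborel {x. norm x > \<epsilon>} (\<lambda>x. (norm (grad u x))\<^sup>2)
                 \<and> set_integrable lborel {x. norm x > \<epsilon>} (\<lambda>x. (u x)\<^sup>2 / (norm x)\<^sup>2))
         \<and> (hardy_truncated u \<longlongrightarrow> L) (at_right 0))"

definition hardy_functional :: "(real ^ 'n \<Rightarrow> real) \<Rightarrow> real" where
  "hardy_functional u = (THE L. has_hardy_value u L)"

definition sq_integral :: "(real ^ 'n \<Rightarrow> real) \<Rightarrow> real" where
  "sq_integral u = (LINT x|lborel. (u x)\<^sup>2)"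

definition admissible :: "(real ^ 'n \<Rightarrow> real) set" where
  "admissible =
     {(\<lambda>x. norm x powr (- ((real CARD('n) - 2) / 2)) * bessel_J0 (norm x) * v x) | v.
        v \<in> test_functions \<and> v \<noteq> (\<lambda>_. 0)}"

end

theory Submission
  imports Defs
begin

text \<open>Put \<open>a = (N - 2) / 2\<close>, \<open>r = |x|\<close> and \<open>\<phi>(x) = r\<^sup>-\<^sup>a J\<^sub>0(r)\<close>, so that \<open>u = \<phi> v\<close>. Bessel's equation
  says that \<open>- \<Delta>\<phi> = a\<^sup>2 \<phi> / r\<^sup>2 + \<phi>\<close> away from the origin. Expanding \<open>|\<nabla>(\<phi> v)|\<^sup>2\<close> and using this
  equation gives the pointwise identity (\<open>hardy_density_identity\<close>)

  \<open>|\<nabla>u|\<^sup>2 - a\<^sup>2 u\<^sup>2 / r\<^sup>2 = \<phi>\<^sup>2 |\<nabla>v|\<^sup>2 + u\<^sup>2 + div(\<phi> v\<^sup>2 \<nabla>\<phi>)\<close>.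

  Here \<open>\<phi> v\<^sup>2 \<nabla>\<phi> = - k x / r\<^sup>N\<close> with \<open>k = (a J\<^sub>0\<^sup>2 - r J\<^sub>0 J\<^sub>0') v\<^sup>2\<close>, which is continuously differentiable with
  compact support, and the divergence is \<open>- (x \<bullet> \<nabla>k) / r\<^sup>N\<close>. All three terms on the right
  are therefore integrable although the two on the left need not be. Since \<open>a > 0\<close>, both integrals
  in the Hardy functional converge or both diverge, and in either case its value is the integral of
  the right-hand side. The field \<open>x / r\<^sup>N\<close> has a constant flux \<open>A \<ge> 0\<close> through spheres
  around the origin, so that the divergence term contributes \<open>A k(0) = A a v(0)\<^sup>2\<close>
  (\<open>integral_radial_derivative_kernel\<close>) and the Hardy functional is

  \<open>\<integral> \<phi>\<^sup>2 |\<nabla>v|\<^sup>2 + \<integral> u\<^sup>2 + A a v(0)\<^sup>2\<close>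

  (\<open>hardy_value_bessel_profile\<close>). The first integral is positive: \<open>J\<^sub>0\<close> and \<open>J\<^sub>0'\<close> have no common zero,
  hence \<open>\<phi>\<close> vanishes on no open set, and \<open>\<nabla>v\<close> is not identically zero because \<open>v\<close> is nonzero
  with compact support. This is the strict inequality, and it shows that the quotient exceeds \<open>1\<close> for
  every admissible function.

  The quotient comes arbitrarily close to \<open>1\<close> for the dilated cut-offs \<open>v(x) = \<beta>(x / R)\<close>.
  Because \<open>|J\<^sub>0| \<le> 1\<close> and \<open>r\<^sup>2 / r\<^sup>N |\<nabla>v|\<^sup>2 dx\<close> is dilation invariant, the integral of
  \<open>\<phi>\<^sup>2 |\<nabla>v|\<^sup>2\<close> stays bounded (\<open>bump_energy_bounded\<close>), and \<open>v(0) = \<beta>(0)\<close> is fixed. But \<open>\<integral> u\<^sup>2\<close> tends to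
  infinity (\<open>bump_mass_lower_bound\<close>): \<open>p = r\<^sup>2 (J\<^sub>0\<^sup>2 + J\<^sub>0'\<^sup>2)\<close> satisfies \<open>dp/dr = 2 r J\<^sub>0\<^sup>2\<close>, so an
  integration by parts bounds \<open>\<integral> u\<^sup>2\<close> from below by a multiple of the value of \<open>p\<close> at \<open>R\<close>, and \<open>p\<close> is unbounded
  (\<open>pohozaev_at_top\<close>). Hence \<open>1\<close> is the infimum of the quotient, and it is not attained.

  The radial integrations are all carried out without polar coordinates, through the vanishing of
  \<open>\<integral> div(h x) dx\<close> for \<open>h\<close> of compact support, which expresses that Lebesgue measure scales like \<open>\<lambda>\<^sup>N\<close>.\<close>

section \<open>The Bessel function as a function of the squared radius\<close>

definition bessel_coeff :: "nat \<Rightarrow> real" where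
  "bessel_coeff k = (-1) ^ k / (4 ^ k * (fact k)\<^sup>2)"

text \<open>\<open>J\<^sub>0\<close> is even. As a function of \<open>s = t\<^sup>2\<close> it is again an entire series, and its composition with
  \<open>|x|\<^sup>2\<close> is smooth at the origin, where \<open>|x|\<close> itself is not.\<close>

definition bess :: "real \<Rightarrow> real" where
  "bess s = (\<Sum>k. bessel_coeff k * s ^ k)"

definition bess' :: "real \<Rightarrow> real" where
  "bess' s = (\<Sum>k. diffs bessel_coeff k * s ^ k)"

definition bess'' :: "real \<Rightarrow> real" where
  "bess'' s = (\<Sum>k. diffs (diffs bessel_coeff) k * s ^ k)"

lemma bessel_J0_eq_bess: "bessel_J0 t = bess (t\<^sup>2)"
  unfolding bessel_J0_def bess_def bessel_coeff_def
  by (intro suminf_cong) (simp add: power_divide power_mult)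

lemma summable_bessel_coeff: "summable (\<lambda>k. bessel_coeff k * x ^ k)"
proof (rule summable_comparison_test)
  have "norm (bessel_coeff k * x ^ k) \<le> norm (inverse (fact k) * \<bar>x\<bar> ^ k)" for k
  proof -
    have 1: "(1::real) \<le> 4 ^ k * fact k"
      using mult_mono[of 1 "4 ^ k :: real" 1 "fact k"] by (simp add: one_le_power)
    have "norm (bessel_coeff k) = inverse (4 ^ k * fact k) * inverse (fact k)"
      by (simp add: bessel_coeff_def power2_eq_square abs_mult power_abs field_simps)
    also have "\<dots> \<le> 1 * inverse (fact k)"
      using 1 by (intro mult_right_mono) (auto simp: inverse_le_1_iff simp del: inverse_mult_distrib)
    finally show ?thesis
      by (simp add: abs_mult power_abs mult_right_mono)
  qed
  thus "\<exists>M. \<forall>k\<ge>M. norm (bessel_coeff k * x ^ k) \<le> norm (inverse (fact k) * \<bar>x\<bar> ^ k)"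
    by blast
  show "summable (\<lambda>k. norm (inverse (fact k) * \<bar>x\<bar> ^ k))"
    using summable_exp[of "\<bar>x\<bar>"] by (simp add: abs_mult power_abs)
qed

lemma DERIV_bess [derivative_intros]:
  "(f has_field_derivative d) (at x within S) \<Longrightarrow>
   ((\<lambda>x. bess (f x)) has_field_derivative bess' (f x) * d) (at x within S)"
  by (rule DERIV_chain2[of bess "bess' (f x)"])
     (auto simp: bess_def[abs_def] bess'_def
        intro!: termdiffs_strong_converges_everywhere summable_bessel_coeff)

lemma DERIV_bess' [derivative_intros]:
  "(f has_field_derivative d) (at x within S) \<Longrightarrow>
   ((\<lambda>x. bess' (f x)) has_field_derivative bess'' (f x) * d) (at x within S)"
  by (rule DERIV_chain2[of bess' "bess'' (f x)"])
     (auto simp: bess'_def[abs_def] bess''_def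
        intro!: termdiffs_strong_converges_everywhere termdiff_converges_all summable_bessel_coeff)

lemma continuous_on_bess [continuous_intros]:
  "continuous_on S f \<Longrightarrow> continuous_on S (\<lambda>x. bess (f x))"
  by (rule continuous_on_compose2[of UNIV bess])
     (auto intro!: DERIV_continuous_on DERIV_bess[OF DERIV_ident])

lemma continuous_on_bess' [continuous_intros]:
  "continuous_on S f \<Longrightarrow> continuous_on S (\<lambda>x. bess' (f x))"
  by (rule continuous_on_compose2[of UNIV bess'])
     (auto intro!: DERIV_continuous_on DERIV_bess'[OF DERIV_ident])

lemma bess_0: "bess 0 = 1"
  unfolding bess_def by (subst suminf_finite[of "{0}"]) (auto simp: bessel_coeff_def)

text \<open>Bessel's equation \<open>J\<^sub>0'' + J\<^sub>0' / t + J\<^sub>0 = 0\<close> in the variable \<open>s = t\<^sup>2\<close>. On coefficients it is the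
  recursion \<open>4 (n + 1)\<^sup>2 c\<^sub>n\<^sub>+\<^sub>1 = - c\<^sub>n\<close>.\<close>

lemma bessel_ode: "4 * s * bess'' s + 4 * bess' s + bess s = 0"
proof -
  let ?c = bessel_coeff
  have c: "(\<lambda>n. ?c n * s ^ n) sums bess s"
    unfolding bess_def by (intro summable_sums summable_bessel_coeff)
  have c1: "(\<lambda>n. diffs ?c n * s ^ n) sums bess' s"
    unfolding bess'_def by (intro summable_sums termdiff_converges_all summable_bessel_coeff)
  have "(\<lambda>n. of_nat n * diffs ?c n * s ^ (n - Suc 0)) sums bess'' s"
    unfolding bess''_def
    by (intro diffs_equiv termdiff_converges_all summable_bessel_coeff)
  from sums_mult[OF this, of s] have c2: "(\<lambda>n. of_nat n * diffs ?c n * s ^ n) sums (s * bess'' s)"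
  proof -
    assume *: "(\<lambda>n. s * (of_nat n * diffs ?c n * s ^ (n - Suc 0))) sums (s * bess'' s)"
    have "(\<lambda>n. s * (of_nat n * diffs ?c n * s ^ (n - Suc 0))) = (\<lambda>n. of_nat n * diffs ?c n * s ^ n)"
      by (rule ext) (case_tac n, auto)
    with * show ?thesis by simp
  qed
  have rec: "4 * (real (Suc n))\<^sup>2 * ?c (Suc n) = - ?c n" for n
    unfolding bessel_coeff_def by (simp add: divide_simps power2_eq_square) 
  have "(\<lambda>n. 4 * (of_nat n * diffs ?c n * s ^ n) + 4 * (diffs ?c n * s ^ n) + ?c n * s ^ n)
      = (\<lambda>n. (4 * (real (Suc n))\<^sup>2 * ?c (Suc n) + ?c n) * s ^ n)"
    by (rule ext) (simp add: diffs_def power2_eq_square algebra_simps)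
  also have "\<dots> = (\<lambda>n. 0)" unfolding rec by simp
  finally have z: "(\<lambda>n. 4 * (of_nat n * diffs ?c n * s ^ n) + 4 * (diffs ?c n * s ^ n) + ?c n * s ^ n)
      = (\<lambda>n. 0)" .
  have "(\<lambda>n. 4 * (of_nat n * diffs ?c n * s ^ n) + 4 * (diffs ?c n * s ^ n) + ?c n * s ^ n)
      sums (4 * (s * bess'' s) + 4 * bess' s + bess s)"
    by (intro sums_add sums_mult c c1 c2)
  from sums_unique2[OF this[unfolded z] sums_zero] show ?thesis by (simp add: mult.assoc)
qed

text \<open>With \<open>s = t\<^sup>2\<close> this is \<open>t\<^sup>2 (J\<^sub>0(t)\<^sup>2 + J\<^sub>0'(t)\<^sup>2)\<close>, the quantity of the Pohozaev identity for Bessel's equation: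
  multiplying the equation by \<open>2 t\<^sup>2 J\<^sub>0'\<close> yields an explicit antiderivative of \<open>2 t J\<^sub>0\<^sup>2\<close>.\<close>

definition pohozaev :: "real \<Rightarrow> real" where
  "pohozaev s = s * (bess s)\<^sup>2 + 4 * s\<^sup>2 * (bess' s)\<^sup>2"

lemma DERIV_pohozaev: "(pohozaev has_real_derivative (bess s)\<^sup>2) (at s)"
proof -
  have "(pohozaev has_real_derivative
      ((bess s)\<^sup>2 + 2 * s * bess s * bess' s + 8 * s * (bess' s)\<^sup>2 + 8 * s\<^sup>2 * bess' s * bess'' s)) (at s)"
    unfolding pohozaev_def[abs_def]
    by (auto intro!: derivative_eq_intros simp: power2_eq_square algebra_simps)
  also have "8 * s\<^sup>2 * bess' s * bess'' s = 2 * s * bess' s * (4 * s * bess'' s)"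
    by (simp add: power2_eq_square)
  also have "4 * s * bess'' s = - 4 * bess' s - bess s"
    using bessel_ode[of s] by linarith
  also have "(bess s)\<^sup>2 + 2 * s * bess s * bess' s + 8 * s * (bess' s)\<^sup>2
      + 2 * s * bess' s * (- 4 * bess' s - bess s) = (bess s)\<^sup>2"
    by (simp add: power2_eq_square algebra_simps)
  finally show ?thesis .
qed

lemma pohozaev_mono: "s \<le> t \<Longrightarrow> pohozaev s \<le> pohozaev t"
  by (rule DERIV_nonneg_imp_nondecreasing) (use DERIV_pohozaev in \<open>auto intro!: exI\<close>)

text \<open>It is positive near \<open>0\<close> because \<open>J\<^sub>0(0) = 1\<close>, and it never decreases. In particular \<open>J\<^sub>0\<close> and
  its derivative have no common zero.\<close>

lemma pohozaev_pos:
  assumes "s > 0" shows "pohozaev s > 0"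
proof -
  have "isCont bess 0"
    using continuous_on_bess[OF continuous_on_id, of UNIV] by (simp add: continuous_on_eq_continuous_at)
  hence "\<forall>\<^sub>F t in at_right 0. bess t > 0"
    unfolding isCont_def using order_tendstoD(1)[of bess "bess 0" "at 0" 0] bess_0
    by (simp add: eventually_at_split)
  hence "\<forall>\<^sub>F t in at_right (0::real). bess t > 0 \<and> t > 0 \<and> t < s"
    using assms by (auto intro!: eventually_conj eventually_at_right_less simp: eventually_at_right_real)
       (auto simp: eventually_at_right)
  then obtain t where t: "bess t > 0" "t > 0" "t < s"
    using eventually_happens[of _ "at_right (0::real)"] by fastforce
  have "0 < t * (bess t)\<^sup>2" using t by simp
  also have "\<dots> \<le> pohozaev t" by (simp add: pohozaev_def)
  also have "\<dots> \<le> pohozaev s" using t by (intro pohozaev_mono) auto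
  finally show ?thesis .
qed

text \<open>The energy \<open>J\<^sub>0\<^sup>2 + J\<^sub>0'\<^sup>2\<close> is damped by the first-order term of the equation, and equals \<open>1\<close> at \<open>0\<close>.\<close>

lemma bess_sq_le_1:
  assumes "s \<ge> 0" shows "(bess s)\<^sup>2 \<le> 1"
proof -
  let ?E = "\<lambda>s. (bess s)\<^sup>2 + 4 * s * (bess' s)\<^sup>2"
  have "(?E has_real_derivative - 4 * (bess' t)\<^sup>2) (at t)" for t
  proof -
    have "(?E has_real_derivative
        (2 * bess t * bess' t + 4 * (bess' t)\<^sup>2 + 2 * bess' t * (4 * t * bess'' t))) (at t)"
      by (auto intro!: derivative_eq_intros simp: power2_eq_square algebra_simps)
    also have "4 * t * bess'' t = - 4 * bess' t - bess t"
      using bessel_ode[of t] by linarith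
    also have "2 * bess t * bess' t + 4 * (bess' t)\<^sup>2 + 2 * bess' t * (- 4 * bess' t - bess t)
        = - 4 * (bess' t)\<^sup>2"
      by (simp add: power2_eq_square algebra_simps)
    finally show ?thesis .
  qed
  hence "?E s \<le> ?E 0"
    by (intro DERIV_nonpos_imp_nonincreasing[OF assms]) (auto intro!: exI)
  moreover have "4 * s * (bess' s)\<^sup>2 \<ge> 0" using assms by simp
  ultimately show ?thesis by (simp add: bess_0)
qed

text \<open>Multiplying the equation by \<open>J\<^sub>0\<close> compares the potential and the kinetic part of the energy: with
  \<open>q = s b b'\<close> one finds \<open>(p + 2 q)' = p / (2 s)\<close>, where \<open>b\<close> is \<open>bess\<close> and \<open>p\<close> is \<open>pohozaev\<close>. As \<open>p\<close> is
  bounded below by \<open>p(1) > 0\<close> for \<open>s \<ge> 1\<close>, the function \<open>p + 2 q\<close> grows at least like a logarithm, and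
  \<open>2 q\<close> is at most \<open>p / 2\<close> there by the arithmetic-geometric mean inequality.\<close>

lemma pohozaev_at_top: "filterlim pohozaev at_top at_top"
proof -
  define q where "q s = s * bess s * bess' s" for s
  \<comment> \<open>the mean inequality gives \<open>4 sqrt s b b' \<le> b\<^sup>2 + 4 s b'\<^sup>2\<close>; for \<open>s \<ge> 1\<close> the factor \<open>sqrt s\<close> may be dropped\<close>
  have q_le: "2 * q s \<le> pohozaev s / 2" if "s \<ge> 1" for s
  proof -
    have "0 \<le> (bess s - 2 * sqrt s * bess' s)\<^sup>2" by simp
    also have "\<dots> = (bess s)\<^sup>2 - 4 * sqrt s * (bess s * bess' s) + 4 * s * (bess' s)\<^sup>2"
      using that by (simp add: power2_diff power_mult_distrib)
    finally have 1: "4 * sqrt s * (bess s * bess' s) \<le> (bess s)\<^sup>2 + 4 * s * (bess' s)\<^sup>2" by simp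
    have 2: "4 * (bess s * bess' s) \<le> (bess s)\<^sup>2 + 4 * s * (bess' s)\<^sup>2"
    proof (cases "bess s * bess' s \<ge> 0")
      case True
      have "sqrt s \<ge> 1" using that by simp
      hence "1 * (bess s * bess' s) \<le> sqrt s * (bess s * bess' s)"
        using True by (rule mult_right_mono)
      thus ?thesis using 1 by simp
    next
      case False
      have "0 \<le> (bess s)\<^sup>2 + 4 * s * (bess' s)\<^sup>2" using that by simp
      thus ?thesis using False by linarith
    qed
    have "s * (4 * (bess s * bess' s)) \<le> s * ((bess s)\<^sup>2 + 4 * s * (bess' s)\<^sup>2)"
      using that by (intro mult_left_mono 2) auto
    thus ?thesis by (simp add: q_def pohozaev_def power2_eq_square algebra_simps)
  qed
  let ?c = "pohozaev 1"
  let ?D = "\<lambda>s. pohozaev s + 2 * q s - ?c / 2 * ln s"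
  have D: "(?D has_real_derivative (pohozaev s / (2 * s) - ?c / (2 * s))) (at s)" if "s \<ge> 1" for s
  proof -
    have "(?D has_real_derivative ((bess s)\<^sup>2 + (2 * bess s * bess' s + 2 * s * (bess' s)\<^sup>2
        + bess s * (4 * s * bess'' s) / 2) - ?c / (2 * s))) (at s)"
      unfolding q_def using that
      by (auto intro!: derivative_eq_intros DERIV_pohozaev
          simp: power2_eq_square algebra_simps)
    also have "4 * s * bess'' s = - 4 * bess' s - bess s"
      using bessel_ode[of s] by linarith
    also have "(bess s)\<^sup>2 + (2 * bess s * bess' s + 2 * s * (bess' s)\<^sup>2
        + bess s * (- 4 * bess' s - bess s) / 2) = pohozaev s / (2 * s)"
      using that by (simp add: pohozaev_def power2_eq_square field_simps)
    finally show ?thesis .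
  qed
  have "?D 1 \<le> ?D s" if "s \<ge> 1" for s
  proof (rule DERIV_nonneg_imp_nondecreasing[OF that])
    fix t :: real assume t: "1 \<le> t" "t \<le> s"
    have "?c \<le> pohozaev t" using t by (intro pohozaev_mono)
    hence "0 \<le> (pohozaev t - ?c) / (2 * t)" using t by simp
    also have "\<dots> = pohozaev t / (2 * t) - ?c / (2 * t)" by (rule diff_divide_distrib)
    finally show "\<exists>y. (?D has_real_derivative y) (at t) \<and> 0 \<le> y" using D[OF t(1)] by blast
  qed
  hence lower: "(2 / 3) * (?D 1 + ?c / 2 * ln s) \<le> pohozaev s" if "s \<ge> 1" for s
    using q_le[OF that] that by fastforce
  have "?c > 0" by (rule pohozaev_pos) simp
  hence "filterlim (\<lambda>s. (2 / 3) * (?D 1 + ?c / 2 * ln s)) at_top at_top"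
    by (intro filterlim_tendsto_pos_mult_at_top[OF tendsto_const]
        filterlim_tendsto_add_at_top[OF tendsto_const] ln_at_top) auto
  thus ?thesis
    by (rule filterlim_at_top_mono) (use lower in \<open>auto simp: eventually_at_top_linorder\<close>)
qed

section \<open>Dilations, singular weights and the radial divergence theorem\<close>

lemma integrable_compact_support:
  fixes f :: "'a::euclidean_space \<Rightarrow> real"
  assumes "continuous_on UNIV f" "\<And>x. norm x \<ge> B \<Longrightarrow> f x = 0"
  shows "integrable lborel f"
proof -
  have "integrable lborel (\<lambda>x. indicator (cball 0 B) x *\<^sub>R f x)"
    by (rule borel_integrable_compact) (auto intro: continuous_on_subset[OF assms(1)])
  also have "(\<lambda>x. indicator (cball 0 B) x *\<^sub>R f x) = f"
    using assms(2) by (auto simp: fun_eq_iff indicator_def not_le)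
  finally show ?thesis .
qed

lemma bounded_compact_support:
  fixes f :: "'a::euclidean_space \<Rightarrow> 'b::real_normed_vector"
  assumes "continuous_on UNIV f" "\<And>x. norm x \<ge> B \<Longrightarrow> f x = 0"
  obtains C where "C > 0" "\<And>x. norm (f x) \<le> C"
proof -
  have "compact (f ` cball 0 B)"
    by (intro compact_continuous_image) (auto intro: continuous_on_subset[OF assms(1)])
  then obtain C where C: "C > 0" "\<And>y. y \<in> f ` cball 0 B \<Longrightarrow> norm y \<le> C"
    using compact_imp_bounded bounded_pos by metis
  have "norm (f x) \<le> C" for x
    using C(2)[of "f x"] assms(2)[of x] C(1) by (cases "norm x \<le> B") auto
  thus ?thesis using C that by blast
qed

lemma integral_lborel_scale:
  fixes f :: "'a::euclidean_space \<Rightarrow> real"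
  assumes "integrable lborel f" "c > 0"
  shows "integrable lborel (\<lambda>x. f (c *\<^sub>R x))"
    and "(LINT x|lborel. f (c *\<^sub>R x)) = (LINT x|lborel. f x) / c ^ DIM('a)"
proof -
  have eq: "lborel = density (distr lborel borel (\<lambda>x::'a. c *\<^sub>R x)) (\<lambda>_. ennreal (c ^ DIM('a)))"
    using lborel_affine[of c "0::'a"] assms(2) by simp
  have m: "f \<in> borel_measurable borel" using assms(1) by auto
  have "integrable (density (distr lborel borel (\<lambda>x::'a. c *\<^sub>R x)) (\<lambda>_. ennreal (c ^ DIM('a)))) f"
    using assms(1) eq by simp
  thus "integrable lborel (\<lambda>x. f (c *\<^sub>R x))"
    using assms(2) m by (subst (asm) integrable_density) (auto simp: integrable_distr_eq)
  have "(LINT x|lborel. f x)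
      = (LINT x|density (distr lborel borel (\<lambda>x::'a. c *\<^sub>R x)) (\<lambda>_. ennreal (c ^ DIM('a))). f x)"
    using eq by simp
  also have "\<dots> = c ^ DIM('a) * (LINT x|lborel. f (c *\<^sub>R x))"
    using assms(2) m by (subst integral_density) (auto simp: integral_distr)
  finally show "(LINT x|lborel. f (c *\<^sub>R x)) = (LINT x|lborel. f x) / c ^ DIM('a)"
    using assms(2) by simp
qed

text \<open>On the dyadic shell \<open>B / 2\<^sup>n\<^sup>+\<^sup>1 < |x| \<le> B / 2\<^sup>n\<close> the function \<open>|x|\<^sup>1\<^sup>-\<^sup>N\<close> is at most \<open>(2\<^sup>n\<^sup>+\<^sup>1 / B)\<^sup>N\<^sup>-\<^sup>1\<close>,
  while the ball containing the shell has volume proportional to \<open>(B / 2\<^sup>n)\<^sup>N\<close>; the products form a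
  geometric series. Written as a quotient of natural powers, the kernel has the value \<open>0\<close>
  at the origin.\<close>

lemma integrable_riesz_kernel:
  "integrable lborel (\<lambda>x::'a::euclidean_space. indicator (cball 0 B) x * (norm x / norm x ^ DIM('a)))"
proof (cases "B > 0")
  case False
  hence "(\<lambda>x::'a. indicator (cball 0 B) x * (norm x / norm x ^ DIM('a))) = (\<lambda>_. 0)"
    by (auto simp: fun_eq_iff indicator_def not_less dest: order_trans[OF _ \<open>\<not> B > 0\<close>[unfolded not_less]])
  thus ?thesis by simp
next
  case B: True
  obtain m where m: "DIM('a) = Suc m"
    using DIM_positive[where 'a='a] gr0_implies_Suc by blast
  define U where "U = unit_ball_vol (real DIM('a))"
  define a where "a n = (2 * 2 ^ n / B) ^ m" for n :: nat
  have a0: "a n \<ge> 0" for n using B by (simp add: a_def)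
  let ?f = "\<lambda>x::'a. indicator (cball 0 B) x * (norm x / norm x ^ DIM('a))"
  have bound: "ennreal (norm (?f x)) \<le> (\<Sum>n. ennreal (a n) * indicator (cball 0 (B / 2 ^ n)) x)" for x
  proof (cases "x = 0 \<or> norm x > B")
    case True
    thus ?thesis by (auto simp: indicator_def)
  next
    case False
    hence x: "norm x > 0" "norm x \<le> B" by auto
    have "(\<lambda>n. B * (1 / 2) ^ n) \<longlonglongrightarrow> B * 0"
      by (intro tendsto_mult tendsto_const LIMSEQ_realpow_zero) auto
    hence "\<forall>\<^sub>F n in sequentially. B * (1 / 2) ^ n < norm x"
      using x(1) by (intro order_tendstoD(2)) auto
    then obtain n0 where "B * (1 / 2) ^ n0 < norm x" by (auto simp: eventually_sequentially)
    hence ex: "B / 2 ^ n0 < norm x" by (simp add: power_one_over)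
    \<comment> \<open>the index of the dyadic shell containing \<open>x\<close> is the predecessor of \<open>n1\<close>\<close>
    define n1 where "n1 = (LEAST n. B / 2 ^ n < norm x)"
    have n1: "B / 2 ^ n1 < norm x" unfolding n1_def by (rule LeastI[of "\<lambda>n. B / 2 ^ n < norm x", OF ex])
    have "n1 \<noteq> 0"
    proof
      assume "n1 = 0"
      with n1 x show False by simp
    qed
    then obtain n where n: "n1 = Suc n" using not0_implies_Suc by blast
    have "\<not> B / 2 ^ n < norm x"
      using not_less_Least[of n "\<lambda>n. B / 2 ^ n < norm x"] n by (simp add: n1_def)
    hence upper: "norm x \<le> B / 2 ^ n" by simp
    have "1 / norm x \<le> 2 * 2 ^ n / B"
      using n1 x B by (simp add: n field_simps)
    hence "(1 / norm x) ^ m \<le> a n" unfolding a_def by (intro power_mono) auto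
    moreover have "norm x / norm x ^ DIM('a) = (1 / norm x) ^ m"
      using x by (simp add: m power_one_over field_simps)
    ultimately have "ennreal (norm (?f x)) \<le> ennreal (a n) * indicator (cball 0 (B / 2 ^ n)) x"
      using x upper by (auto simp: indicator_def intro!: ennreal_leI)
    also have "\<dots> \<le> (\<Sum>n. ennreal (a n) * indicator (cball 0 (B / 2 ^ n)) x)"
      using sum_le_suminf[of "\<lambda>n. ennreal (a n) * indicator (cball 0 (B / 2 ^ n)) x" "{n}"]
      by (simp del: sum_mult_indicator sum_indicator_mult)
    finally show ?thesis .
  qed
  have "(\<integral>\<^sup>+x. ennreal (norm (?f x)) \<partial>lborel)
      \<le> (\<integral>\<^sup>+x. (\<Sum>n. ennreal (a n) * indicator (cball 0 (B / 2 ^ n)) x) \<partial>(lborel::'a measure))"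
    by (intro nn_integral_mono bound)
  also have "\<dots> = (\<Sum>n. \<integral>\<^sup>+x. ennreal (a n) * indicator (cball 0 (B / 2 ^ n)) x \<partial>(lborel::'a measure))"
    by (rule nn_integral_suminf)
       (intro borel_measurable_times_ennreal borel_measurable_const borel_measurable_indicator, auto)
  also have "\<dots> = (\<Sum>n. ennreal (U * 2 ^ m * B * (1 / 2) ^ n))"
  proof (intro suminf_cong)
    fix n
    have "a n * (B / 2 ^ n) ^ DIM('a) = (2 * 2 ^ n / B * (B / 2 ^ n)) ^ m * (B / 2 ^ n)"
      unfolding a_def m power_mult_distrib power_Suc by (simp add: mult_ac)
    also have "2 * 2 ^ n / B * (B / 2 ^ n) = 2" using B by simp
    finally have *: "a n * (B / 2 ^ n) ^ DIM('a) = 2 ^ m * (B / 2 ^ n)" .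
    have "(\<integral>\<^sup>+x. ennreal (a n) * indicator (cball 0 (B / 2 ^ n)) x \<partial>(lborel::'a measure))
        = ennreal (a n) * emeasure lborel (cball 0 (B / 2 ^ n) :: 'a set)"
      by (rule nn_integral_cmult_indicator) auto
    also have "\<dots> = ennreal (a n * (U * (B / 2 ^ n) ^ DIM('a)))"
      using B a0[of n] by (simp add: emeasure_cball U_def ennreal_mult')
    also have "a n * (U * (B / 2 ^ n) ^ DIM('a)) = U * (a n * (B / 2 ^ n) ^ DIM('a))" by simp
    also have "\<dots> = U * 2 ^ m * B * (1 / 2) ^ n"
      unfolding * by (simp add: power_one_over field_simps)
    finally show "(\<integral>\<^sup>+x. ennreal (a n) * indicator (cball 0 (B / 2 ^ n)) x \<partial>(lborel::'a measure))
      = ennreal (U * 2 ^ m * B * (1 / 2) ^ n)" .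
  qed
  also have "\<dots> < \<infinity>"
  proof -
    have "summable (\<lambda>n. U * 2 ^ m * B * (1 / 2 :: real) ^ n)"
      by (intro summable_mult summable_geometric) auto
    moreover have "U \<ge> 0" by (simp add: U_def)
    ultimately show ?thesis using B
      by (subst suminf_ennreal2) auto
  qed
  finally have "(\<integral>\<^sup>+x. ennreal (norm (?f x)) \<partial>lborel) < \<infinity>" .
  moreover have "cball (0::'a) B \<in> sets borel" by simp
  hence "?f \<in> borel_measurable lborel" by measurable
  ultimately show ?thesis by (intro integrableI_bounded) auto
qed

lemma integrable_riesz_bound:
  fixes f :: "'a::euclidean_space \<Rightarrow> real"
  assumes "f \<in> borel_measurable borel"
    and "\<And>x. \<bar>f x\<bar> \<le> C * (norm x / norm x ^ DIM('a))"
    and "\<And>x. norm x \<ge> B \<Longrightarrow> f x = 0"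
  shows "integrable lborel f"
proof (rule Bochner_Integration.integrable_bound)
  show "integrable lborel (\<lambda>x::'a. C * (indicator (cball 0 B) x * (norm x / norm x ^ DIM('a))))"
    by (intro integrable_mult_right integrable_riesz_kernel)
  show "AE x in lborel. norm (f x) \<le> norm (C * (indicator (cball 0 B) x * (norm x / norm x ^ DIM('a))))"
  proof (rule AE_I2)
    fix x :: 'a
    show "norm (f x) \<le> norm (C * (indicator (cball 0 B) x * (norm x / norm x ^ DIM('a))))"
    proof (cases "norm x \<le> B")
      case True
      thus ?thesis using order_trans[OF assms(2)[of x] abs_ge_self] by (simp add: indicator_def)
    next
      case False
      thus ?thesis using assms(3)[of x] by simp
    qed
  qed
qed (use assms in auto)

text \<open>A continuously differentiable function of compact support, together with its gradient. Carrying the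
  gradient explicitly keeps the formulas for products and compositions free of description operators.\<close>

definition C1_compact :: "('a::euclidean_space \<Rightarrow> real) \<Rightarrow> ('a \<Rightarrow> 'a) \<Rightarrow> bool" where
  "C1_compact v G \<longleftrightarrow> (\<forall>x. GDERIV v x :> G x) \<and> continuous_on UNIV G
     \<and> (\<exists>B. \<forall>x. norm x \<ge> B \<longrightarrow> v x = 0)"

lemma GDERIV_unique: "GDERIV f x :> D \<Longrightarrow> GDERIV f x :> E \<Longrightarrow> D = E"
  unfolding gderiv_def using has_derivative_unique[of f "\<lambda>h. h \<bullet> D" x "\<lambda>h. h \<bullet> E"]
  by (auto simp: fun_eq_iff intro!: vector_eq_ldot[THEN iffD1])

lemma GDERIV_zero_if_locally_zero:
  assumes "GDERIV f x :> D" "open S" "x \<in> S" "\<And>y. y \<in> S \<Longrightarrow> f y = 0"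
  shows "D = 0"
proof -
  have "GDERIV (\<lambda>_. 0) x :> D"
    using assms unfolding gderiv_def by (rule has_derivative_transform_within_open)
  thus ?thesis using GDERIV_unique GDERIV_const by blast
qed

lemma C1_compact_support:
  assumes "C1_compact v G"
  obtains B where "B > 0" "\<And>x. norm x \<ge> B \<Longrightarrow> v x = 0" "\<And>x. norm x \<ge> B \<Longrightarrow> G x = 0"
proof -
  from assms obtain B where B: "\<And>x. norm x \<ge> B \<Longrightarrow> v x = 0" by (auto simp: C1_compact_def)
  have "G x = 0" if "norm x \<ge> \<bar>B\<bar> + 1" for x
  proof (rule GDERIV_zero_if_locally_zero)
    show "GDERIV v x :> G x" using assms by (simp add: C1_compact_def)
    show "open {x. norm x > B}" by (intro open_Collect_less continuous_intros)
    show "x \<in> {x. norm x > B}" using that by auto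
    show "v y = 0" if "y \<in> {x. norm x > B}" for y using that B by auto
  qed
  thus ?thesis using B by (intro that[of "\<bar>B\<bar> + 1"]) auto
qed

lemma C1_compact_continuous:
  assumes "C1_compact v G"
  shows "continuous_on UNIV v" "continuous_on UNIV G"
proof -
  have "(v has_derivative (\<lambda>h. h \<bullet> G x)) (at x)" for x
    using assms by (simp add: C1_compact_def gderiv_def)
  thus "continuous_on UNIV v"
    using has_derivative_continuous continuous_at_imp_continuous_on by metis
  show "continuous_on UNIV G"
    using assms by (simp add: C1_compact_def)
qed

lemma C1_compact_bound:
  assumes "C1_compact v G"
  obtains C where "C > 0" "\<And>x. \<bar>v x\<bar> \<le> C" "\<And>x. norm (G x) \<le> C"
proof -
  obtain B where B: "\<And>x. norm x \<ge> B \<Longrightarrow> v x = 0" "\<And>x. norm x \<ge> B \<Longrightarrow> G x = 0"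
    using C1_compact_support[OF assms] by metis
  obtain C1 where 1: "C1 > 0" "\<And>x. norm (v x) \<le> C1"
    using bounded_compact_support[OF C1_compact_continuous(1)[OF assms] B(1)] by blast
  obtain C2 where 2: "C2 > 0" "\<And>x. norm (G x) \<le> C2"
    using bounded_compact_support[OF C1_compact_continuous(2)[OF assms] B(2)] by blast
  show ?thesis
    using 1(2) 2(2) 1(1) by (intro that[of "max C1 C2"]) (auto simp: le_max_iff_disj)
qed

text \<open>The integrand is the divergence of \<open>h(x) x\<close>. The integral of \<open>\<lambda>\<^sup>N h(\<lambda> x)\<close> does not depend on \<open>\<lambda>\<close>; the claim is that
  its derivative at \<open>\<lambda> = 1\<close> vanishes. The derivative is taken along \<open>\<lambda> = 1 + 1 / (n + 1)\<close>, where the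
  difference quotients of \<open>h(\<lambda> x)\<close> are dominated by means of the mean value theorem. Values
  \<open>\<lambda> \<ge> 1\<close> do not enlarge the support.\<close>

lemma integral_radial_divergence:
  fixes h :: "'a::euclidean_space \<Rightarrow> real"
  assumes "C1_compact h G"
  shows "(LINT x|lborel. real DIM('a) * h x + x \<bullet> G x) = 0"
proof -
  have der: "GDERIV h x :> G x" for x using assms by (simp add: C1_compact_def)
  note cont = C1_compact_continuous[OF assms]
  obtain B where B: "B > 0" "\<And>x. norm x \<ge> B \<Longrightarrow> h x = 0" "\<And>x. norm x \<ge> B \<Longrightarrow> G x = 0"
    using C1_compact_support[OF assms] by blast
  obtain C where C: "C > 0" "\<And>x. norm (G x) \<le> C"
    using C1_compact_bound[OF assms] by metis
  have int_h: "integrable lborel h" by (rule integrable_compact_support[OF cont(1) B(2)])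
  have int_G: "integrable lborel (\<lambda>x. x \<bullet> G x)"
    by (rule integrable_compact_support[of _ B]) (auto intro!: continuous_intros cont simp: B)
  define I where "I = (LINT x|lborel. h x)"
  let ?t = "\<lambda>n. 1 / real (Suc n)"
  have t0: "?t \<longlonglongrightarrow> 0" by (rule LIMSEQ_Suc[OF lim_1_over_n])
  hence tf: "filterlim ?t (at 0) sequentially"
    by (intro filterlim_atI) auto
  define q where "q n x = (h ((1 + ?t n) *\<^sub>R x) - h x) / ?t n" for n x
  have path: "((\<lambda>t. h ((1 + t) *\<^sub>R x)) has_real_derivative (x \<bullet> G ((1 + t) *\<^sub>R x))) (at t)" for x t
  proof -
    have "((\<lambda>t. (1 + t) *\<^sub>R x) has_derivative (\<lambda>s. s *\<^sub>R x)) (at t)"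
      by (auto intro!: derivative_eq_intros)
    from has_derivative_compose[OF this der[unfolded gderiv_def]] show ?thesis
      unfolding has_field_derivative_def by (rule has_derivative_eq_rhs) (simp add: fun_eq_iff)
  qed
  have "(\<lambda>n. LINT x|lborel. q n x) \<longlonglongrightarrow> (LINT x|lborel. x \<bullet> G x)"
  proof (rule integral_dominated_convergence[where w = "\<lambda>x. C * B * indicator (cball 0 B) x"])
    show "(\<lambda>x. x \<bullet> G x) \<in> borel_measurable lborel" using int_G by auto
    have "q n \<in> borel_measurable borel" for n
      unfolding q_def[abs_def]
      by (intro borel_measurable_continuous_onI continuous_intros continuous_on_compose2[OF cont(1)]) auto
    thus "q n \<in> borel_measurable lborel" for n by simp
    show "integrable lborel (\<lambda>x::'a. C * B * indicator (cball 0 B) x)"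
      by (intro integrable_mult_right integrable_real_indicator)
         (auto simp: emeasure_cball B(1) less_imp_le)
    show "AE x in lborel. (\<lambda>n. q n x) \<longlonglongrightarrow> x \<bullet> G x"
    proof (rule AE_I2)
      fix x
      have "((\<lambda>t. (h ((1 + t) *\<^sub>R x) - h x) / t) \<longlongrightarrow> x \<bullet> G x) (at 0)"
        using path[of x 0] by (simp add: has_field_derivative_iff)
      from filterlim_compose[OF this tf] show "(\<lambda>n. q n x) \<longlonglongrightarrow> x \<bullet> G x"
        by (simp add: q_def)
    qed
    show "AE x in lborel. norm (q n x) \<le> C * B * indicator (cball 0 B) x" for n
    proof (rule AE_I2)
      fix x :: 'a
      show "norm (q n x) \<le> C * B * indicator (cball 0 B) x"
      proof (cases "norm x \<le> B")
        case True
        have "0 < ?t n" by simp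
        from MVT2[OF this, of "\<lambda>t. h ((1 + t) *\<^sub>R x)" "\<lambda>t. x \<bullet> G ((1 + t) *\<^sub>R x)"] path
        obtain z where "h ((1 + ?t n) *\<^sub>R x) - h x = ?t n * (x \<bullet> G ((1 + z) *\<^sub>R x))"
          by (auto simp del: of_nat_Suc)
        hence "q n x = x \<bullet> G ((1 + z) *\<^sub>R x)" by (simp add: q_def del: of_nat_Suc)
        also have "\<bar>\<dots>\<bar> \<le> norm x * norm (G ((1 + z) *\<^sub>R x))" by (rule Cauchy_Schwarz_ineq2)
        also have "\<dots> \<le> B * C" using True C B(1) by (intro mult_mono) auto
        finally show ?thesis using True by (simp add: mult.commute)
      next
        case False
        have "1 * norm x \<le> (1 + ?t n) * norm x" by (intro mult_right_mono) auto
        hence "norm ((1 + ?t n) *\<^sub>R x) \<ge> B" using False by (simp add: abs_of_nonneg)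
        thus ?thesis using False B(2) by (simp add: q_def)
      qed
    qed
  qed
  moreover have "(\<lambda>n. LINT x|lborel. q n x) \<longlonglongrightarrow> - real DIM('a) * I"
  proof -
    have "(LINT x|lborel. q n x) = I * ((1 / (1 + ?t n) ^ DIM('a) - 1) / ?t n)" for n
    proof -
      have p: "1 + ?t n > 0" by (simp add: add_pos_pos)
      have "(LINT x|lborel. q n x) = ((LINT x|lborel. h ((1 + ?t n) *\<^sub>R x)) - I) / ?t n"
        unfolding q_def I_def integral_divide_zero
        by (subst Bochner_Integration.integral_diff)
           (use integral_lborel_scale(1)[OF int_h p] int_h in auto)
      also have "(LINT x|lborel. h ((1 + ?t n) *\<^sub>R x)) = I / (1 + ?t n) ^ DIM('a)"
        unfolding I_def by (rule integral_lborel_scale(2)[OF int_h p])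
      finally show ?thesis by (simp add: field_simps)
    qed
    moreover have "((\<lambda>t. (1 / (1 + t) ^ DIM('a) - 1) / t) \<longlongrightarrow> - real DIM('a)) (at 0)"
    proof -
      have "((\<lambda>t::real. 1 / (1 + t) ^ DIM('a)) has_real_derivative - real DIM('a)) (at 0)"
        by (auto intro!: derivative_eq_intros)
      thus ?thesis by (simp add: has_field_derivative_iff)
    qed
    from tendsto_mult[OF tendsto_const[of I] filterlim_compose[OF this tf]]
    have "(\<lambda>n. I * ((1 / (1 + ?t n) ^ DIM('a) - 1) / ?t n)) \<longlonglongrightarrow> I * (- real DIM('a))" .
    ultimately show ?thesis by (simp add: mult.commute)
  qed
  ultimately have "(LINT x|lborel. x \<bullet> G x) = - real DIM('a) * I"
    by (rule LIMSEQ_unique)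
  thus ?thesis
    using int_h int_G by (simp add: I_def)
qed

section \<open>The flux of a radial vector field through the origin\<close>

lemma DERIV_max_0_square: "((\<lambda>t::real. (max 0 t)\<^sup>2) has_real_derivative 2 * max 0 t) (at t)"
proof -
  consider "t > 0" | "t < 0" | "t = 0" by linarith
  thus ?thesis
  proof cases
    case 1
    have "((\<lambda>t::real. t\<^sup>2) has_real_derivative 2 * max 0 t) (at t)"
      using 1 by (auto intro!: derivative_eq_intros)
    thus ?thesis
      by (rule has_field_derivative_transform_within_open[of _ _ _ "{0<..}"]) (use 1 in auto)
  next
    case 2
    have "((\<lambda>t::real. 0) has_real_derivative 2 * max 0 t) (at t)" using 2 by simp
    thus ?thesis
      by (rule has_field_derivative_transform_within_open[of _ _ _ "{..<0}"]) (use 2 in auto)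
  next
    case 3
    have "((\<lambda>h::real. (max 0 h)\<^sup>2 / h) \<longlongrightarrow> 0) (at 0)"
    proof (rule Lim_null_comparison)
      show "\<forall>\<^sub>F h in at 0. norm ((max 0 h)\<^sup>2 / h) \<le> \<bar>h::real\<bar>"
        by (intro always_eventually allI) (auto simp: max_def power2_eq_square)
      show "((\<lambda>h::real. \<bar>h\<bar>) \<longlongrightarrow> 0) (at 0)" by (intro tendsto_rabs_zero tendsto_ident_at)
    qed
    thus ?thesis using 3 by (simp add: has_field_derivative_iff)
  qed
qed

text \<open>A transition from \<open>0\<close> on \<open>s \<le> 1\<close> to \<open>1\<close> on \<open>s \<ge> 2\<close> that is increasing and continuously differentiable, since it
  is composed of affine maps and the function \<open>t \<mapsto> max(0, t)\<^sup>2\<close>.\<close>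

definition ramp :: "real \<Rightarrow> real" where
  "ramp s = 1 - (max 0 (1 - (max 0 (s - 1))\<^sup>2))\<^sup>2"

definition ramp' :: "real \<Rightarrow> real" where
  "ramp' s = 4 * max 0 (1 - (max 0 (s - 1))\<^sup>2) * max 0 (s - 1)"

lemma DERIV_ramp [derivative_intros]:
  assumes "(f has_field_derivative d) (at x within S)"
  shows "((\<lambda>x. ramp (f x)) has_field_derivative ramp' (f x) * d) (at x within S)"
proof -
  have "((\<lambda>s. 1 - (max 0 (1 - (max 0 (s - 1))\<^sup>2))\<^sup>2) has_real_derivative ramp' s) (at s)" for s
  proof -
    have 1: "((\<lambda>s. (max 0 (s - 1))\<^sup>2) has_real_derivative 2 * max 0 (s - 1) * (1 - 0)) (at s)"
      by (rule DERIV_chain2[OF DERIV_max_0_square DERIV_diff[OF DERIV_ident DERIV_const]])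
    have "((\<lambda>s. 1 - (max 0 (1 - (max 0 (s - 1))\<^sup>2))\<^sup>2) has_real_derivative
        0 - 2 * max 0 (1 - (max 0 (s - 1))\<^sup>2) * (0 - 2 * max 0 (s - 1) * (1 - 0))) (at s)"
      by (rule DERIV_diff[OF DERIV_const DERIV_chain2[OF DERIV_max_0_square DERIV_diff[OF DERIV_const 1]]])
    thus ?thesis by (simp add: ramp'_def mult.assoc)
  qed
  from DERIV_chain2[OF this assms] show ?thesis by (simp add: ramp_def)
qed

lemma continuous_on_ramp [continuous_intros]:
  "continuous_on S f \<Longrightarrow> continuous_on S (\<lambda>x. ramp (f x))"
  "continuous_on S f \<Longrightarrow> continuous_on S (\<lambda>x. ramp' (f x))"
  unfolding ramp_def ramp'_def by (intro continuous_intros; assumption)+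

lemma ramp_bounds: "0 \<le> ramp s" "ramp s \<le> 1" "0 \<le> ramp' s"
proof -
  have "max 0 (1 - (max 0 (s - 1))\<^sup>2) \<le> 1" by simp
  hence "(max 0 (1 - (max 0 (s - 1))\<^sup>2))\<^sup>2 \<le> 1\<^sup>2" by (intro power_mono) auto
  thus "0 \<le> ramp s" by (simp add: ramp_def)
qed (auto simp: ramp_def ramp'_def)

lemma ramp_eq_0: "s \<le> 1 \<Longrightarrow> ramp s = 0" "s \<le> 1 \<Longrightarrow> ramp' s = 0"
  by (auto simp: ramp_def ramp'_def max_def)

lemma ramp_eq_1:
  assumes "s \<ge> 2" shows "ramp s = 1" "ramp' s = 0"
proof -
  have "1\<^sup>2 \<le> (s - 1)\<^sup>2" using assms by (intro power_mono) auto
  thus "ramp s = 1" "ramp' s = 0" using assms by (auto simp: ramp_def ramp'_def max_def intro: antisym)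
qed

lemma continuous_if_zero_near_0:
  fixes f :: "'a::real_normed_vector \<Rightarrow> 'b::real_normed_vector"
  assumes "continuous_on (- {0}) f" "r > 0" "\<And>x. norm x < r \<Longrightarrow> f x = 0"
  shows "continuous_on UNIV f"
proof -
  have "continuous_on (ball 0 r) f"
    by (subst continuous_on_cong[OF refl, of _ _ "\<lambda>_. 0"]) (use assms(3) in auto)
  with assms(1) have "continuous_on (- {0} \<union> ball 0 r) f"
    by (intro continuous_on_open_Un) auto
  also have "- {0} \<union> ball 0 r = (UNIV :: 'a set)" using assms(2) by auto
  finally show ?thesis .
qed

text \<open>The kernel \<open>|x|\<^sup>-\<^sup>N\<close> cut off at radius \<open>d\<close>: it vanishes near the origin, which makes its product with
  \<open>k\<close> eligible for the radial divergence theorem.\<close>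

lemma C1_compact_times_truncated_kernel:
  fixes k :: "'a::euclidean_space \<Rightarrow> real"
  assumes k: "C1_compact k K" and d: "d > 0"
  defines "\<theta> \<equiv> \<lambda>x::'a. ramp ((norm x)\<^sup>2 / d\<^sup>2) / norm x ^ DIM('a)"
    and "\<Theta> \<equiv> \<lambda>x::'a. (2 * ramp' ((norm x)\<^sup>2 / d\<^sup>2) / d\<^sup>2 / norm x ^ DIM('a)
            - real DIM('a) * ramp ((norm x)\<^sup>2 / d\<^sup>2) / norm x ^ (DIM('a) + 2)) *\<^sub>R x"
  shows "C1_compact (\<lambda>x. k x * \<theta> x) (\<lambda>x. k x *\<^sub>R \<Theta> x + \<theta> x *\<^sub>R K x)"
proof -
  note cont = C1_compact_continuous[OF k]
  have small: "(norm x)\<^sup>2 / d\<^sup>2 \<le> 1" if "norm x < d" for x :: 'a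
    using that d power_mono[of "norm x" d 2] by simp
  have z: "\<theta> x = 0" "\<Theta> x = 0" if "norm x < d" for x
    using small[OF that] by (simp_all add: \<theta>_def \<Theta>_def ramp_eq_0)
  have der: "GDERIV \<theta> x :> \<Theta> x" for x
  proof (cases "x = 0")
    case True
    have "GDERIV (\<lambda>_. 0) x :> \<Theta> x" using z(2)[of x] d True GDERIV_const by simp
    thus ?thesis unfolding gderiv_def
      by (rule has_derivative_transform_within_open[where s = "ball 0 d"]) (use True d z in auto)
  next
    case False
    hence r: "norm x > 0" by simp
    have "((\<lambda>r. ramp (r\<^sup>2 / d\<^sup>2) / r ^ DIM('a)) has_real_derivative
        (2 * ramp' ((norm x)\<^sup>2 / d\<^sup>2) / d\<^sup>2 / norm x ^ DIM('a)
            - real DIM('a) * ramp ((norm x)\<^sup>2 / d\<^sup>2) / norm x ^ (DIM('a) + 2)) * norm x) (at (norm x))"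
    proof -
      obtain m where m: "DIM('a) = Suc m"
        using DIM_positive[where 'a='a] gr0_implies_Suc by blast
      have rm: "norm x ^ m \<noteq> 0" using r by simp
      show ?thesis unfolding m
        by (rule derivative_eq_intros refl | use r d in force)+
           (use r d rm in \<open>simp add: field_simps power2_eq_square\<close>)
    qed
    from GDERIV_DERIV_compose[OF GDERIV_norm[OF False] this]
    show ?thesis using r by (simp add: \<theta>_def \<Theta>_def sgn_div_norm mult.assoc)
  qed
  have c1: "continuous_on UNIV \<theta>"
    by (rule continuous_if_zero_near_0[OF _ d z(1)])
       (use d in \<open>auto simp: \<theta>_def intro!: continuous_intros\<close>)
  have c2: "continuous_on UNIV \<Theta>"
    by (rule continuous_if_zero_near_0[OF _ d z(2)])
       (use d in \<open>auto simp: \<Theta>_def intro!: continuous_intros\<close>)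
  have "\<exists>B. \<forall>x. norm x \<ge> B \<longrightarrow> k x * \<theta> x = 0"
    using k by (auto simp: C1_compact_def)
  moreover have "GDERIV (\<lambda>x. k x * \<theta> x) x :> k x *\<^sub>R \<Theta> x + \<theta> x *\<^sub>R K x" for x
    by (rule GDERIV_mult[OF _ der]) (use k in \<open>simp add: C1_compact_def\<close>)
  ultimately show ?thesis
    unfolding C1_compact_def by (auto intro!: continuous_intros cont c1 c2)
qed

lemma integrable_radial_derivative_kernel:
  fixes k :: "'a::euclidean_space \<Rightarrow> real"
  assumes k: "C1_compact k K"
  shows "integrable lborel (\<lambda>x. x \<bullet> K x / norm x ^ DIM('a))"
proof -
  obtain B where B: "\<And>x. norm x \<ge> B \<Longrightarrow> K x = 0" using C1_compact_support[OF k] by metis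
  obtain C where C: "\<And>x. norm (K x) \<le> C" using C1_compact_bound[OF k] by metis
  have [measurable]: "K \<in> borel_measurable borel"
    by (rule borel_measurable_continuous_onI[OF C1_compact_continuous(2)[OF k]])
  show ?thesis
  proof (rule integrable_riesz_bound[of _ C B])
    fix x :: 'a
    have "\<bar>x \<bullet> K x\<bar> \<le> norm x * norm (K x)" by (rule Cauchy_Schwarz_ineq2)
    also have "\<dots> \<le> norm x * C" by (intro mult_left_mono C) auto
    finally show "\<bar>x \<bullet> K x / norm x ^ DIM('a)\<bar> \<le> C * (norm x / norm x ^ DIM('a))"
      by (simp add: divide_right_mono mult.commute)
  qed (use B in auto)
qed

text \<open>Off the origin, \<open>x \<bullet> \<nabla>k / |x|\<^sup>N\<close> is the divergence of \<open>k x / |x|\<^sup>N\<close>, and \<open>A\<close> is the area of the unit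
  sphere. Apply the radial divergence theorem to \<open>k\<close> times the kernel truncated at radius \<open>d\<close>. Besides the
  truncated integrand this leaves the integral of \<open>k\<close> against a function concentrated on
  \<open>d \<le> |x| \<le> 2 d\<close>. Rescaled to unit size this function becomes \<open>q\<close>, which does not depend on
  \<open>d\<close>, and as \<open>d\<close> tends to \<open>0\<close> the factor \<open>k(d y)\<close> tends to \<open>k(0)\<close>. So \<open>A\<close> is obtained as the integral of \<open>q\<close>.\<close>

lemma integral_radial_derivative_kernel:
  obtains A :: real where "A \<ge> 0"
    "\<And>(k :: 'a::euclidean_space \<Rightarrow> real) K. C1_compact k K \<Longrightarrow>
       (LINT x|lborel. x \<bullet> K x / norm x ^ DIM('a)) = - A * k 0"
proof -
  define q :: "'a \<Rightarrow> real" where "q y = 2 * ramp' ((norm y)\<^sup>2) * (norm y)\<^sup>2 / norm y ^ DIM('a)" for y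
  have q0: "q y = 0" if "norm y < 1" for y
    using that power_mono[of "norm y" 1 2] by (simp add: q_def ramp_eq_0)
  have q1: "q y = 0" if "norm y \<ge> 2" for y
    using that power_mono[of 2 "norm y" 2] by (simp add: q_def ramp_eq_1)
  have q_cont: "continuous_on UNIV q"
    by (rule continuous_if_zero_near_0[OF _ zero_less_one q0])
       (auto simp: q_def intro!: continuous_intros)
  have q_int: "integrable lborel q" by (rule integrable_compact_support[OF q_cont q1])
  define A where "A = (LINT y|lborel. q y)"
  have "A \<ge> 0" unfolding A_def
    by (intro integral_nonneg_AE AE_I2) (simp add: q_def ramp_bounds)
  moreover have "(LINT x|lborel. x \<bullet> K x / norm x ^ DIM('a)) = - A * k 0"
    if k: "C1_compact k K" for k :: "'a \<Rightarrow> real" and K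
  proof -
    note cont = C1_compact_continuous[OF k]
    obtain B where B: "B > 0" "\<And>x. norm x \<ge> B \<Longrightarrow> k x = 0" "\<And>x. norm x \<ge> B \<Longrightarrow> K x = 0"
      using C1_compact_support[OF k] by metis
    obtain C where C: "C > 0" "\<And>x. \<bar>k x\<bar> \<le> C"
      using C1_compact_bound[OF k] by metis
    have [measurable]: "k \<in> borel_measurable borel" "K \<in> borel_measurable borel"
        "q \<in> borel_measurable borel" "ramp \<in> borel_measurable borel"
      using cont q_cont continuous_on_ramp(1)[OF continuous_on_id]
      by (auto intro: borel_measurable_continuous_onI)
    have int0: "integrable lborel (\<lambda>x. x \<bullet> K x / norm x ^ DIM('a))"
      by (rule integrable_radial_derivative_kernel[OF k])
    have dom: "\<bar>ramp s * t\<bar> \<le> \<bar>t\<bar>" for s t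
      using ramp_bounds[of s] mult_right_mono[of "ramp s" 1 "\<bar>t\<bar>"] by (simp add: abs_mult)
    have step: "(LINT x|lborel. ramp ((norm x)\<^sup>2 / d\<^sup>2) * (x \<bullet> K x / norm x ^ DIM('a)))
        = - (LINT y|lborel. k (d *\<^sub>R y) * q y)" if d: "d > 0" for d
    proof -
      let ?f = "\<lambda>x. k x * q (x /\<^sub>R d) / d ^ DIM('a)"
      have intf: "integrable lborel ?f"
        by (rule integrable_compact_support[of _ B])
           (auto intro!: continuous_intros cont continuous_on_compose2[OF q_cont] simp: B d[THEN less_imp_neq, symmetric])
      have int1: "integrable lborel (\<lambda>x. ramp ((norm x)\<^sup>2 / d\<^sup>2) * (x \<bullet> K x / norm x ^ DIM('a)))"
      proof (rule Bochner_Integration.integrable_bound[OF int0])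
        show "AE x in lborel. norm (ramp ((norm x)\<^sup>2 / d\<^sup>2) * (x \<bullet> K x / norm x ^ DIM('a)))
            \<le> norm (x \<bullet> K x / norm x ^ DIM('a))"
          unfolding real_norm_def by (rule AE_I2) (rule dom)
      qed auto
      have "0 = (LINT x|lborel. ramp ((norm x)\<^sup>2 / d\<^sup>2) * (x \<bullet> K x / norm x ^ DIM('a)) + ?f x)"
        unfolding integral_radial_divergence[OF C1_compact_times_truncated_kernel[OF k d], symmetric]
      proof (intro Bochner_Integration.integral_cong refl)
        fix x :: 'a
        show "real DIM('a) * (k x * (ramp ((norm x)\<^sup>2 / d\<^sup>2) / norm x ^ DIM('a))) +
            x \<bullet> (k x *\<^sub>R ((2 * ramp' ((norm x)\<^sup>2 / d\<^sup>2) / d\<^sup>2 / norm x ^ DIM('a)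
              - real DIM('a) * ramp ((norm x)\<^sup>2 / d\<^sup>2) / norm x ^ (DIM('a) + 2)) *\<^sub>R x)
              + (ramp ((norm x)\<^sup>2 / d\<^sup>2) / norm x ^ DIM('a)) *\<^sub>R K x)
          = ramp ((norm x)\<^sup>2 / d\<^sup>2) * (x \<bullet> K x / norm x ^ DIM('a)) + k x * q (x /\<^sub>R d) / d ^ DIM('a)"
        proof (cases "x = 0")
          case True
          thus ?thesis by (simp add: q0)
        next
          case False
          have "q (x /\<^sub>R d) / d ^ DIM('a)
              = 2 * ramp' ((norm x)\<^sup>2 / d\<^sup>2) * ((norm x)\<^sup>2 / d\<^sup>2) / norm x ^ DIM('a)"
            using d by (simp add: q_def power_mult_distrib power_inverse field_simps)
          moreover have "norm x ^ (DIM('a) + 2) = norm x ^ DIM('a) * (norm x)\<^sup>2"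
            by (rule power_add)
          moreover have "x \<bullet> x = (norm x)\<^sup>2" by (rule power2_norm_eq_inner[symmetric])
          moreover have "n * (c * (r / P)) + (c * ((2 * r' / D / P - n * r / (P * s)) * s) + r / P * t)
              = r * (t / P) + c * (2 * r' * (s / D) / P)"
            if "P \<noteq> 0" "s \<noteq> 0" "D \<noteq> 0" for n c r P r' D s t :: real
            using that by (simp add: field_simps)
          ultimately show ?thesis using False d
            by (simp only: inner_add_right inner_scaleR_right times_divide_eq_right[of "k x", symmetric]) simp
        qed
      qed
      also have "\<dots> = (LINT x|lborel. ramp ((norm x)\<^sup>2 / d\<^sup>2) * (x \<bullet> K x / norm x ^ DIM('a)))
          + (LINT x|lborel. ?f x)"
        by (rule Bochner_Integration.integral_add[OF int1 intf])
      also have "(LINT x|lborel. ?f x) = d ^ DIM('a) * (LINT y|lborel. ?f (d *\<^sub>R y))"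
        using integral_lborel_scale(2)[OF intf d] d by simp
      also have "\<dots> = (LINT y|lborel. d ^ DIM('a) * ?f (d *\<^sub>R y))"
        by (rule integral_mult_right_zero[symmetric])
      also have "\<dots> = (LINT y|lborel. k (d *\<^sub>R y) * q y)"
        using d by (intro Bochner_Integration.integral_cong) auto
      finally show ?thesis by simp
    qed
    let ?t = "\<lambda>n. 1 / real (Suc n)"
    have t0: "?t \<longlonglongrightarrow> 0" by (rule LIMSEQ_Suc[OF lim_1_over_n])
    have L: "(\<lambda>n. LINT x|lborel. ramp ((norm x)\<^sup>2 / (?t n)\<^sup>2) * (x \<bullet> K x / norm x ^ DIM('a)))
        \<longlonglongrightarrow> (LINT x|lborel. x \<bullet> K x / norm x ^ DIM('a))"
    proof (rule integral_dominated_convergence[OF _ _ integrable_norm[OF int0]])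
      show "AE x in lborel. (\<lambda>n. ramp ((norm x)\<^sup>2 / (?t n)\<^sup>2) * (x \<bullet> K x / norm x ^ DIM('a)))
          \<longlonglongrightarrow> x \<bullet> K x / norm x ^ DIM('a)"
      proof (rule AE_I2)
        fix x :: 'a
        show "(\<lambda>n. ramp ((norm x)\<^sup>2 / (?t n)\<^sup>2) * (x \<bullet> K x / norm x ^ DIM('a)))
          \<longlonglongrightarrow> x \<bullet> K x / norm x ^ DIM('a)"
        proof (cases "x = 0")
          case False
          hence "norm x / 2 > 0" by simp
          with t0 have "\<forall>\<^sub>F n in sequentially. ?t n < norm x / 2"
            by (intro order_tendstoD(2)) auto
          hence "\<forall>\<^sub>F n in sequentially. x \<bullet> K x / norm x ^ DIM('a)
              = ramp ((norm x)\<^sup>2 / (?t n)\<^sup>2) * (x \<bullet> K x / norm x ^ DIM('a))"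
          proof eventually_elim
            case (elim n)
            have p: "?t n > 0" by simp
            have "2 \<le> norm x / ?t n" using elim p by (simp add: field_simps del: of_nat_Suc)
            from power_mono[OF this, of 2] have "2 \<le> (norm x)\<^sup>2 / (?t n)\<^sup>2"
              unfolding power_divide by simp
            thus ?case by (simp add: ramp_eq_1)
          qed
          from tendsto_cong[THEN iffD1, OF this tendsto_const] show ?thesis .
        qed simp
      qed
      show "AE x in lborel. norm (ramp ((norm x)\<^sup>2 / (?t n)\<^sup>2) * (x \<bullet> K x / norm x ^ DIM('a)))
          \<le> norm (x \<bullet> K x / norm x ^ DIM('a))" for n
        unfolding real_norm_def by (rule AE_I2) (rule dom)
    qed auto
    have R: "(\<lambda>n. LINT y|lborel. k (?t n *\<^sub>R y) * q y) \<longlonglongrightarrow> (LINT y|lborel. k 0 * q y)"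
    proof (rule integral_dominated_convergence[where w = "\<lambda>y. C * norm (q y)"])
      show "integrable lborel (\<lambda>y. C * norm (q y))"
        by (intro integrable_mult_right integrable_norm q_int)
      show "AE y in lborel. (\<lambda>n. k (?t n *\<^sub>R y) * q y) \<longlonglongrightarrow> k 0 * q y"
      proof (rule AE_I2)
        fix y :: 'a
        have "(\<lambda>n. ?t n *\<^sub>R y) \<longlonglongrightarrow> 0 *\<^sub>R y" by (intro tendsto_scaleR t0 tendsto_const)
        moreover have "isCont k 0" using cont(1) by (simp add: continuous_on_eq_continuous_at)
        ultimately have "(\<lambda>n. k (?t n *\<^sub>R y)) \<longlonglongrightarrow> k 0"
          using isCont_tendsto_compose[of 0 k "\<lambda>n. ?t n *\<^sub>R y" sequentially] by simp
        thus "(\<lambda>n. k (?t n *\<^sub>R y) * q y) \<longlonglongrightarrow> k 0 * q y" by (intro tendsto_mult tendsto_const)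
      qed
      show "AE y in lborel. norm (k (?t n *\<^sub>R y) * q y) \<le> C * norm (q y)" for n
        by (rule AE_I2) (simp add: abs_mult mult_right_mono C)
    qed auto
    have "?t n > 0" for n by simp
    from step[OF this] have "(\<lambda>n. LINT x|lborel. ramp ((norm x)\<^sup>2 / (?t n)\<^sup>2) * (x \<bullet> K x / norm x ^ DIM('a)))
        = (\<lambda>n. - (LINT y|lborel. k (?t n *\<^sub>R y) * q y))" by blast
    with L have "(\<lambda>n. - (LINT y|lborel. k (?t n *\<^sub>R y) * q y))
        \<longlonglongrightarrow> (LINT x|lborel. x \<bullet> K x / norm x ^ DIM('a))" by simp
    from LIMSEQ_unique[OF this tendsto_minus[OF R]]
    show ?thesis by (simp add: A_def)
  qed
  ultimately show ?thesis using that by blast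
qed

section \<open>The ground state substitution\<close>

lemma grad_eq: "GDERIV f x :> D \<Longrightarrow> grad f x = D"
  unfolding grad_def using GDERIV_unique by blast

lemma GDERIV_norm_square: "GDERIV (\<lambda>x. (norm x)\<^sup>2) x :> 2 *\<^sub>R x"
  unfolding gderiv_def power2_norm_eq_inner
  by (auto intro!: derivative_eq_intros simp: inner_commute)

text \<open>Radial factors that occur below are the flux function of the ground state substitution and the
  Pohozaev quantity. As functions of the squared norm they are differentiable at the origin, too.\<close>

lemma C1_compact_radial_times_square:
  assumes v: "C1_compact v G"
    and F: "\<And>s. (F has_real_derivative F' s) (at s)" and F': "continuous_on UNIV F'"
  shows "C1_compact (\<lambda>x. F ((norm x)\<^sup>2) * (v x)\<^sup>2)
    (\<lambda>x. (2 * F' ((norm x)\<^sup>2) * (v x)\<^sup>2) *\<^sub>R x + (2 * F ((norm x)\<^sup>2) * v x) *\<^sub>R G x)"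
proof -
  note cont = C1_compact_continuous[OF v]
  have F_cont: "continuous_on UNIV F" using F DERIV_continuous_on has_field_derivative_at_within by metis
  have "GDERIV (\<lambda>x. F ((norm x)\<^sup>2) * (v x)\<^sup>2) x
      :> (2 * F' ((norm x)\<^sup>2) * (v x)\<^sup>2) *\<^sub>R x + (2 * F ((norm x)\<^sup>2) * v x) *\<^sub>R G x" for x
  proof -
    have v_der: "GDERIV v x :> G x" using v by (simp add: C1_compact_def)
    have sq: "((\<lambda>t::real. t\<^sup>2) has_real_derivative 2 * t) (at t)" for t
      by (auto intro!: derivative_eq_intros)
    from GDERIV_mult[OF GDERIV_DERIV_compose[OF GDERIV_norm_square F] GDERIV_DERIV_compose[OF v_der sq]]
    show ?thesis by (rule GDERIV_subst) (simp add: algebra_simps)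
  qed
  moreover have "\<exists>B. \<forall>x. norm x \<ge> B \<longrightarrow> F ((norm x)\<^sup>2) * (v x)\<^sup>2 = 0"
    using v by (auto simp: C1_compact_def)
  moreover have "continuous_on UNIV (\<lambda>x. (2 * F' ((norm x)\<^sup>2) * (v x)\<^sup>2) *\<^sub>R x + (2 * F ((norm x)\<^sup>2) * v x) *\<^sub>R G x)"
    by (intro continuous_intros cont continuous_on_compose2[OF F_cont] continuous_on_compose2[OF F']) auto
  ultimately show ?thesis unfolding C1_compact_def by blast
qed

text \<open>The square of \<open>|x|\<^sup>-\<^sup>a J\<^sub>0(|x|)\<close> for \<open>a = (N - 2) / 2\<close>, the factor \<open>|x|\<^sup>2\<^sup>-\<^sup>N\<close> being written with natural powers.\<close>

definition bessel_weight :: "'a::euclidean_space \<Rightarrow> real" where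
  "bessel_weight x = (norm x)\<^sup>2 / norm x ^ DIM('a) * (bess ((norm x)\<^sup>2))\<^sup>2"

lemma bessel_weight_nonneg: "bessel_weight x \<ge> 0"
  by (simp add: bessel_weight_def)

lemma bessel_weight_le: "bessel_weight (x::'a::euclidean_space) \<le> (norm x)\<^sup>2 / norm x ^ DIM('a)"
  unfolding bessel_weight_def by (rule mult_right_le_one_le) (auto simp: bess_sq_le_1)

lemma measurable_bess [measurable]: "bess \<in> borel_measurable borel"
  by (intro borel_measurable_continuous_onI continuous_on_bess continuous_on_id)

lemma measurable_bessel_weight [measurable]: "bessel_weight \<in> borel_measurable borel"
  unfolding bessel_weight_def[abs_def] by measurable

lemma integrable_dominated_weight:
  fixes F :: "'a::euclidean_space \<Rightarrow> real"
  assumes "continuous_on UNIV F" "\<And>x. norm x \<ge> B \<Longrightarrow> F x = 0"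
    and [measurable]: "w \<in> borel_measurable borel" and w: "\<And>x. \<bar>w x\<bar> \<le> (norm x)\<^sup>2 / norm x ^ DIM('a)"
  shows "integrable lborel (\<lambda>x. w x * F x)"
proof -
  obtain C where C: "C > 0" "\<And>x. norm (F x) \<le> C"
    using bounded_compact_support[OF assms(1,2)] by metis
  have [measurable]: "F \<in> borel_measurable borel" using assms(1) by (rule borel_measurable_continuous_onI)
  show ?thesis
  proof (rule integrable_riesz_bound[of _ "C * \<bar>B\<bar>" B])
    fix x :: 'a
    show "\<bar>w x * F x\<bar> \<le> C * \<bar>B\<bar> * (norm x / norm x ^ DIM('a))"
    proof (cases "norm x \<ge> B")
      case True
      thus ?thesis using assms(2) C(1) by simp
    next
      case False
      have "\<bar>w x\<bar> \<le> norm x * (norm x / norm x ^ DIM('a))"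
        using w[of x] by (simp add: power2_eq_square)
      also have "\<dots> \<le> \<bar>B\<bar> * (norm x / norm x ^ DIM('a))"
        using False by (intro mult_right_mono) auto
      finally have "\<bar>w x\<bar> * \<bar>F x\<bar> \<le> (\<bar>B\<bar> * (norm x / norm x ^ DIM('a))) * C"
        using C by (intro mult_mono) auto
      thus ?thesis by (simp add: abs_mult mult_ac)
    qed
  qed (use assms in auto)
qed

lemma integrable_bessel_weight:
  fixes F :: "'a::euclidean_space \<Rightarrow> real"
  assumes "continuous_on UNIV F" "\<And>x. norm x \<ge> B \<Longrightarrow> F x = 0"
  shows "integrable lborel (\<lambda>x. bessel_weight x * F x)"
  by (rule integrable_dominated_weight[OF assms])
     (auto simp: abs_of_nonneg bessel_weight_nonneg bessel_weight_le)

lemma AE_lborel_open: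
  fixes U :: "'a::euclidean_space set"
  assumes "AE x in lborel. P x" "open U" "U \<noteq> {}"
  shows "\<exists>x\<in>U. P x"
proof (rule ccontr)
  assume "\<not> (\<exists>x\<in>U. P x)"
  moreover obtain N where N: "N \<in> null_sets lborel" "\<And>x. x \<in> space lborel - N \<Longrightarrow> P x"
    using AE_E3[OF assms(1)] by metis
  ultimately have "U \<subseteq> N" by auto
  hence "U \<in> null_sets lborel"
    using null_sets_subset[OF N(1), of U] assms(2) by auto
  hence "negligible U"
    using negligible_iff_null_sets null_sets_completionI by blast
  thus False using open_not_negligible assms by blast
qed

text \<open>Otherwise \<open>J\<^sub>0(|x|)\<close> would vanish on the open set where \<open>F\<close> is not zero, apart from the origin, hence on an
  interval of radii. There the derivative of \<open>J\<^sub>0\<close> would vanish as well, contrary to \<open>pohozaev_pos\<close>.\<close>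

lemma integral_bessel_weight_pos:
  fixes F :: "'a::euclidean_space \<Rightarrow> real"
  assumes cont: "continuous_on UNIV F" and supp: "\<And>x. norm x \<ge> B \<Longrightarrow> F x = 0"
    and nonneg: "\<And>x. F x \<ge> 0" and x0: "F x0 \<noteq> 0"
  shows "(LINT x|lborel. bessel_weight x * F x) > 0"
proof (rule ccontr)
  assume "\<not> ?thesis"
  moreover have "(LINT x|lborel. bessel_weight x * F x) \<ge> 0"
    by (intro integral_nonneg_AE AE_I2 mult_nonneg_nonneg bessel_weight_nonneg nonneg)
  ultimately have "(LINT x|lborel. bessel_weight x * F x) = 0" by linarith
  hence ae: "AE x in lborel. bessel_weight x * F x = 0"
    by (subst (asm) integral_nonneg_eq_0_iff_AE)
       (auto intro!: integrable_bessel_weight[OF cont supp] mult_nonneg_nonneg bessel_weight_nonneg nonneg)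
  define U where "U = {x. F x \<noteq> 0}"
  have U: "open U" unfolding U_def
    by (intro open_Collect_neq continuous_intros cont)
  have "\<exists>x\<in>U. x \<noteq> 0"
    by (rule AE_lborel_open[OF AE_lborel_singleton U]) (use x0 in \<open>auto simp: U_def\<close>)
  then obtain x1 where x1: "x1 \<in> U" "x1 \<noteq> 0" by blast
  have zero: "bess ((norm x)\<^sup>2) = 0" if "x \<in> U" "x \<noteq> 0" for x
  proof (rule ccontr)
    assume nz: "bess ((norm x)\<^sup>2) \<noteq> 0"
    let ?V = "U \<inter> {x. x \<noteq> 0} \<inter> {x::'a. bess ((norm x)\<^sup>2) \<noteq> 0}"
    have "open ?V"
      by (intro open_Int U open_Collect_neq continuous_intros)
    moreover have "x \<in> ?V" using that nz by simp
    hence "?V \<noteq> {}" by blast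
    ultimately have "\<exists>y\<in>?V. bessel_weight y * F y = 0" by (rule AE_lborel_open[OF ae])
    thus False by (auto simp: U_def bessel_weight_def)
  qed
  define s where "s = (norm x1)\<^sup>2"
  have s: "s > 0" using x1 by (simp add: s_def)
  \<comment> \<open>the ray through \<open>x1\<close>, parametrized by the squared norm\<close>
  let ?\<gamma> = "\<lambda>t. sqrt (t / s) *\<^sub>R x1"
  have "open (?\<gamma> -` U)" by (intro open_vimage U continuous_intros) (use s in auto)
  hence op: "open (?\<gamma> -` U \<inter> {0<..})" by auto
  have "bess t = 0" if "t \<in> ?\<gamma> -` U \<inter> {0<..}" for t
    using zero[of "?\<gamma> t"] that s x1(2) by (simp add: power_mult_distrib s_def[symmetric])
  moreover have mem: "s \<in> ?\<gamma> -` U \<inter> {0<..}" using s x1 by simp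
  moreover have "(bess has_real_derivative bess' s) (at s)"
    using DERIV_bess[OF DERIV_ident] by simp
  hence "GDERIV bess s :> bess' s" by simp
  ultimately have "bess' s = 0" using op GDERIV_zero_if_locally_zero by metis
  moreover have "bess s = 0" using zero[OF x1] by (simp add: s_def)
  ultimately have "pohozaev s = 0" by (simp add: pohozaev_def)
  thus False using pohozaev_pos[OF s] by simp
qed

definition bessel_profile :: "real \<Rightarrow> ('a::euclidean_space \<Rightarrow> real) \<Rightarrow> 'a \<Rightarrow> real" where
  "bessel_profile a v x = norm x powr (- a) * bessel_J0 (norm x) * v x"

lemma powr_half_square:
  assumes "a = (real n - 2) / 2" "r \<ge> 0" "n > 0"
  shows "(r powr (- a))\<^sup>2 = r\<^sup>2 / r ^ n"
proof (cases "r = 0")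
  case False
  hence r: "r > 0" using assms by simp
  have "- a + - a = 2 - real n" using assms(1) by (simp add: field_simps)
  hence "(r powr (- a))\<^sup>2 = r powr (2 - real n)"
    by (simp only: power2_eq_square powr_add[symmetric])
  also have "\<dots> = r\<^sup>2 / r ^ n"
    using r by (simp add: powr_diff powr_realpow)
  finally show ?thesis .
qed (use assms in simp)

lemma bessel_profile_square:
  fixes v :: "'a::euclidean_space \<Rightarrow> real"
  assumes "a = (real DIM('a) - 2) / 2"
  shows "(bessel_profile a v x)\<^sup>2 = bessel_weight x * (v x)\<^sup>2"
  using powr_half_square[OF assms, of "norm x"]
  by (simp add: bessel_profile_def bessel_weight_def power_mult_distrib bessel_J0_eq_bess)

lemma GDERIV_bessel_profile:
  assumes "x \<noteq> 0" "GDERIV v x :> g"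
  shows "GDERIV (bessel_profile a v) x :>
    norm x powr (- a) *\<^sub>R (bess ((norm x)\<^sup>2) *\<^sub>R g
      + (v x * (2 * bess' ((norm x)\<^sup>2) - a * bess ((norm x)\<^sup>2) / (norm x)\<^sup>2)) *\<^sub>R x)"
proof -
  have r: "norm x > 0" using assms by simp
  let ?r = "norm x"
  have "((\<lambda>r. r powr (- a) * bess (r\<^sup>2)) has_real_derivative
      (?r powr (- a) * (2 * bess' (?r\<^sup>2) - a * bess (?r\<^sup>2) / ?r\<^sup>2)) * ?r) (at ?r)"
    using r by (auto intro!: derivative_eq_intros simp: powr_diff field_simps power2_eq_square)
  from GDERIV_mult[OF GDERIV_DERIV_compose[OF GDERIV_norm[OF assms(1)] this] assms(2)]
  have "GDERIV (\<lambda>x. norm x powr (- a) * bess ((norm x)\<^sup>2) * v x) x :>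
    norm x powr (- a) *\<^sub>R (bess ((norm x)\<^sup>2) *\<^sub>R g
      + (v x * (2 * bess' ((norm x)\<^sup>2) - a * bess ((norm x)\<^sup>2) / (norm x)\<^sup>2)) *\<^sub>R x)"
    by (rule GDERIV_subst) (use r in \<open>simp add: sgn_div_norm scaleR_add_right\<close>)
  thus ?thesis by (simp add: bessel_profile_def[abs_def] bessel_J0_eq_bess)
qed

text \<open>With \<open>s = r\<^sup>2\<close> this is \<open>a J\<^sub>0\<^sup>2 - r J\<^sub>0 J\<^sub>0'\<close>, that is \<open>- r\<^sup>N\<^sup>-\<^sup>1 \<phi> \<phi>'\<close> for the radial function
  \<open>\<phi> = r\<^sup>-\<^sup>a J\<^sub>0(r)\<close> and \<open>a = (N - 2) / 2\<close>.\<close>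

definition flux :: "real \<Rightarrow> real \<Rightarrow> real" where
  "flux a s = a * (bess s)\<^sup>2 - 2 * s * bess s * bess' s"

definition flux' :: "real \<Rightarrow> real \<Rightarrow> real" where
  "flux' a s = 2 * a * bess s * bess' s - 2 * s * (bess' s)\<^sup>2 + (bess s)\<^sup>2 / 2"

lemma DERIV_flux: "(flux a has_real_derivative flux' a s) (at s)"
proof -
  have "(flux a has_real_derivative
      (2 * a * bess s * bess' s - 2 * bess s * bess' s - 2 * s * (bess' s)\<^sup>2 - bess s * (4 * s * bess'' s) / 2)) (at s)"
    unfolding flux_def[abs_def]
    by (auto intro!: derivative_eq_intros simp: power2_eq_square algebra_simps)
  also have "4 * s * bess'' s = - 4 * bess' s - bess s"
    using bessel_ode[of s] by linarith
  finally show ?thesis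
    by (rule DERIV_cong) (simp add: flux'_def power2_eq_square field_simps)
qed

lemma continuous_flux': "continuous_on UNIV (flux' a)"
  unfolding flux'_def[abs_def] by (intro continuous_intros) auto

text \<open>The third summand is the divergence of \<open>\<phi> v\<^sup>2 \<nabla>\<phi>\<close> with \<open>\<phi> = |x|\<^sup>-\<^sup>a J\<^sub>0(|x|)\<close>. It absorbs both the mixed term
  of \<open>|\<nabla>(\<phi> v)|\<^sup>2\<close> and, through the equation for \<open>\<phi>\<close> that is contained in the formula for \<open>flux'\<close>, the part of
  \<open>v\<^sup>2 |\<nabla>\<phi>|\<^sup>2\<close> not accounted for by \<open>a\<^sup>2 u\<^sup>2 / |x|\<^sup>2 + u\<^sup>2\<close>.\<close>

lemma hardy_density_identity:
  fixes v :: "'a::euclidean_space \<Rightarrow> real"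
  assumes x: "x \<noteq> 0" and g: "GDERIV v x :> g" and a: "a = (real DIM('a) - 2) / 2"
  shows "(norm (grad (bessel_profile a v) x))\<^sup>2 =
     bessel_weight x * (norm g)\<^sup>2 + (bessel_profile a v x)\<^sup>2
     - (x \<bullet> ((2 * flux' a ((norm x)\<^sup>2) * (v x)\<^sup>2) *\<^sub>R x + (2 * flux a ((norm x)\<^sup>2) * v x) *\<^sub>R g)) / norm x ^ DIM('a)
     + a\<^sup>2 * ((bessel_profile a v x)\<^sup>2 / (norm x)\<^sup>2)"
proof -
  define s where "s = (norm x)\<^sup>2"
  have s: "s > 0" using x by (simp add: s_def)
  define b where "b = bess s"
  define b1 where "b1 = bess' s"
  define y where "y = v x"
  define c where "c = y * (2 * b1 - a * b / s)"
  have W: "(norm x powr (- a))\<^sup>2 = s / norm x ^ DIM('a)"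
    unfolding s_def by (rule powr_half_square[OF a]) auto
  have "(norm (grad (bessel_profile a v) x))\<^sup>2 = (norm x powr (- a))\<^sup>2 * (norm (b *\<^sub>R g + c *\<^sub>R x))\<^sup>2"
    unfolding grad_eq[OF GDERIV_bessel_profile[OF x g]]
    by (simp add: power_mult_distrib b_def b1_def c_def y_def s_def)
  also have "(norm (b *\<^sub>R g + c *\<^sub>R x))\<^sup>2 = b\<^sup>2 * (norm g)\<^sup>2 + 2 * b * c * (x \<bullet> g) + c\<^sup>2 * s"
    unfolding s_def power2_norm_eq_inner
    by (simp add: inner_add_left inner_add_right inner_commute power2_eq_square algebra_simps)
  finally have 1: "(norm (grad (bessel_profile a v) x))\<^sup>2
      = s / norm x ^ DIM('a) * (b\<^sup>2 * (norm g)\<^sup>2 + 2 * b * c * (x \<bullet> g) + c\<^sup>2 * s)"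
    unfolding W .
  have cs: "c * s = y * (2 * b1 * s - a * b)" using s by (simp add: c_def field_simps)
  have "s * (b\<^sup>2 * (norm g)\<^sup>2 + 2 * b * c * (x \<bullet> g) + c\<^sup>2 * s)
      = s * (b\<^sup>2 * (norm g)\<^sup>2) + 2 * b * (c * s) * (x \<bullet> g) + (c * s)\<^sup>2"
    by (simp add: power2_eq_square algebra_simps)
  also have "\<dots> = s * b\<^sup>2 * (norm g)\<^sup>2 + s * b\<^sup>2 * y\<^sup>2
      - (2 * (2 * a * b * b1 - 2 * s * b1\<^sup>2 + b\<^sup>2 / 2) * y\<^sup>2 * s + 2 * (a * b\<^sup>2 - 2 * s * b * b1) * y * (x \<bullet> g))
      + a\<^sup>2 * (b\<^sup>2 * y\<^sup>2)"
    unfolding cs by (simp add: power2_eq_square algebra_simps)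
  finally have 2: "s * (b\<^sup>2 * (norm g)\<^sup>2 + 2 * b * c * (x \<bullet> g) + c\<^sup>2 * s) = \<dots>" .
  have xx: "x \<bullet> x = s" by (simp add: s_def power2_norm_eq_inner)
  have "(norm (grad (bessel_profile a v) x))\<^sup>2
      = (s * (b\<^sup>2 * (norm g)\<^sup>2 + 2 * b * c * (x \<bullet> g) + c\<^sup>2 * s)) / norm x ^ DIM('a)"
    unfolding 1 by simp
  also have "\<dots> = bessel_weight x * (norm g)\<^sup>2 + bessel_weight x * (v x)\<^sup>2
     - (x \<bullet> ((2 * flux' a ((norm x)\<^sup>2) * (v x)\<^sup>2) *\<^sub>R x + (2 * flux a ((norm x)\<^sup>2) * v x) *\<^sub>R g)) / norm x ^ DIM('a)
     + a\<^sup>2 * (bessel_weight x * (v x)\<^sup>2 / (norm x)\<^sup>2)"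
    unfolding 2 bessel_weight_def flux_def flux'_def inner_add_right inner_scaleR_right
      s_def[symmetric] b_def[symmetric] b1_def[symmetric] y_def[symmetric] xx
    using s by (simp add: add_divide_distrib diff_divide_distrib mult_ac)
  finally show ?thesis unfolding bessel_profile_square[OF a] .
qed

section \<open>The value of the Hardy functional\<close>

lemma hardy_functional_eqI:
  assumes "has_hardy_value u L"
  shows "hardy_functional u = L"
  unfolding hardy_functional_def
proof (rule the_equality)
  show "has_hardy_value u L" by (rule assms)
next
  fix L' assume "has_hardy_value u L'"
  with assms show "L' = L"
    unfolding has_hardy_value_def
    by (auto split: if_splits intro: tendsto_unique[OF trivial_limit_at_right_real])
qed

text \<open>If the difference of the two densities is an integrable function \<open>g\<close>, then the two integrals converge or
  diverge together because the Hardy constant is positive. In the first case the value is the integral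
  of \<open>g\<close> by linearity; in the second case the truncated functionals are integrals of \<open>g\<close>, which converge by
  dominated convergence.\<close>

lemma has_hardy_value_if_regular_difference:
  fixes u :: "real ^ 'n \<Rightarrow> real"
  assumes N: "CARD('n) \<ge> 3"
    and [measurable]: "u \<in> borel_measurable borel"
    and u2: "integrable lborel (\<lambda>x. (u x)\<^sup>2)"
    and g: "integrable lborel g"
    and eq: "\<And>x. x \<noteq> 0 \<Longrightarrow>
      (norm (grad u x))\<^sup>2 = g x + hardy_const TYPE('n) * ((u x)\<^sup>2 / (norm x)\<^sup>2)"
  shows "has_hardy_value u (LINT x|lborel. g x)"
proof -
  define c where "c = hardy_const TYPE('n)"
  have c: "c > 0" using N by (simp add: c_def hardy_const_def)
  let ?D = "\<lambda>x. (norm (grad u x))\<^sup>2" and ?H = "\<lambda>x. (u x)\<^sup>2 / (norm x)\<^sup>2"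
  have [measurable]: "g \<in> borel_measurable borel" using g by auto
  have "?D = (\<lambda>x. if x = 0 then ?D 0 else g x + c * ?H x)"
    using eq by (auto simp: c_def fun_eq_iff)
  moreover have "\<dots> \<in> borel_measurable borel" by measurable
  ultimately have [measurable]: "?D \<in> borel_measurable borel" by simp
  have ae: "AE x in lborel. ?D x = g x + c * ?H x"
    using AE_lborel_singleton[of "0 :: real ^ 'n"] by eventually_elim (auto simp: eq c_def)
  have HD: "integrable lborel ?D" if "integrable lborel ?H"
  proof -
    have "integrable lborel (\<lambda>x. g x + c * ?H x)"
      by (intro Bochner_Integration.integrable_add integrable_mult_right that g)
    thus ?thesis by (rule integrable_cong_AE_imp) (use ae in \<open>auto elim: eventually_mono\<close>)
  qed
  have DH: "integrable lborel ?H" if "integrable lborel ?D"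
  proof -
    have int: "integrable lborel (\<lambda>x. (?D x - g x) / c)" using that g by simp
    have m: "?H \<in> borel_measurable lborel" by simp
    have "AE x in lborel. (?D x - g x) / c = ?H x"
      using ae by eventually_elim (use c in auto)
    from integrable_cong_AE_imp[OF int m this] show ?thesis .
  qed
  show ?thesis
  proof (cases "integrable lborel ?D \<or> integrable lborel ?H")
    case True
    hence int: "integrable lborel ?D" "integrable lborel ?H" using HD DH by blast+
    have "(LINT x|lborel. ?D x) = (LINT x|lborel. g x + c * ?H x)"
      by (rule integral_cong_AE) (use ae in auto)
    also have "\<dots> = (LINT x|lborel. g x) + c * (LINT x|lborel. ?H x)"
      using Bochner_Integration.integral_add[OF g integrable_mult_right[OF int(2), of c]]
      by (simp only: integral_mult_right_zero)
    finally show ?thesis using True int unfolding has_hardy_value_def c_def by simp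
  next
    case False
    have S: "{x :: real ^ 'n. norm x > \<epsilon>} \<in> sets lborel" for \<epsilon> by measurable
    have setg: "set_integrable lborel {x. norm x > \<epsilon>} g" for \<epsilon>
      unfolding set_integrable_def by (rule integrable_mult_indicator[OF S g])
    have setH: "set_integrable lborel {x. norm x > \<epsilon>} ?H" if "\<epsilon> > 0" for \<epsilon>
      unfolding set_integrable_def
    proof (rule Bochner_Integration.integrable_bound)
      show "integrable lborel (\<lambda>x. (u x)\<^sup>2 / \<epsilon>\<^sup>2)" using u2 by simp
      show "AE x in lborel. norm (indicat_real {x. norm x > \<epsilon>} x *\<^sub>R ?H x) \<le> norm ((u x)\<^sup>2 / \<epsilon>\<^sup>2)"
      proof (rule AE_I2)
        fix x :: "real ^ 'n"
        show "norm (indicat_real {x. norm x > \<epsilon>} x *\<^sub>R ?H x) \<le> norm ((u x)\<^sup>2 / \<epsilon>\<^sup>2)"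
        proof (cases "norm x > \<epsilon>")
          case True
          hence "\<epsilon>\<^sup>2 \<le> (norm x)\<^sup>2" using that by (intro power_mono) auto
          thus ?thesis using that True by (auto simp: frac_le)
        qed auto
      qed
    qed (use S in measurable)
    have cong: "set_integrable lborel {x. norm x > \<epsilon>} ?D
        \<and> (LINT x:{x. norm x > \<epsilon>}|lborel. ?D x)
          = (LINT x:{x. norm x > \<epsilon>}|lborel. g x) + c * (LINT x:{x. norm x > \<epsilon>}|lborel. ?H x)"
      if "\<epsilon> > 0" for \<epsilon>
    proof -
      have 1: "?D x = g x + c * ?H x" if "x \<in> {x. norm x > \<epsilon>}" for x
        using that \<open>\<epsilon> > 0\<close> by (subst eq) (auto simp: c_def)
      have cH: "set_integrable lborel {x. norm x > \<epsilon>} (\<lambda>x. c * ?H x)"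
        using setH[OF that] by (intro set_integrable_mult_right)
      have 2: "set_integrable lborel {x. norm x > \<epsilon>} (\<lambda>x. g x + c * ?H x)"
        by (rule set_integral_add(1)[OF setg cH])
      have "set_integrable lborel {x. norm x > \<epsilon>} ?D
          \<longleftrightarrow> set_integrable lborel {x. norm x > \<epsilon>} (\<lambda>x. g x + c * ?H x)"
        by (rule set_integrable_cong[OF refl refl 1])
      moreover have "(LINT x:{x. norm x > \<epsilon>}|lborel. ?D x)
          = (LINT x:{x. norm x > \<epsilon>}|lborel. g x + c * ?H x)"
        by (rule set_lebesgue_integral_cong) (use 1 S in auto)
      moreover have "\<dots> = (LINT x:{x. norm x > \<epsilon>}|lborel. g x) + (LINT x:{x. norm x > \<epsilon>}|lborel. c * ?H x)"
        by (rule set_integral_add(2)[OF setg cH])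
      ultimately show ?thesis using 2 by (simp only: set_integral_mult_right simp_thms)
    qed
    have trunc: "hardy_truncated u \<epsilon> = (LINT x:{x. norm x > \<epsilon>}|lborel. g x)" if "\<epsilon> > 0" for \<epsilon>
      using cong[OF that] by (simp add: hardy_truncated_def c_def)
    have "(hardy_truncated u \<longlongrightarrow> (LINT x|lborel. g x)) (at_right 0)"
    proof (rule tendsto_at_right_sequentially[of 0 1])
      fix E :: "nat \<Rightarrow> real"
      assume E: "\<And>n. 0 < E n" "E \<longlonglongrightarrow> 0"
      have "(\<lambda>n. LINT x:{x. norm x > E n}|lborel. g x) \<longlonglongrightarrow> (LINT x|lborel. g x)"
        unfolding set_lebesgue_integral_def
      proof (rule integral_dominated_convergence[OF _ _ integrable_norm[OF g]])
        show "AE x in lborel. (\<lambda>n. indicat_real {x. norm x > E n} x *\<^sub>R g x) \<longlonglongrightarrow> g x"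
          using AE_lborel_singleton[of "0 :: real ^ 'n"]
        proof eventually_elim
          fix x :: "real ^ 'n" assume "x \<noteq> 0"
          hence "\<forall>\<^sub>F n in sequentially. E n < norm x"
            using E(2) by (intro order_tendstoD(2)) auto
          hence "\<forall>\<^sub>F n in sequentially. g x = indicat_real {x. norm x > E n} x *\<^sub>R g x"
            by eventually_elim simp
          from tendsto_cong[THEN iffD1, OF this tendsto_const]
          show "(\<lambda>n. indicat_real {x. norm x > E n} x *\<^sub>R g x) \<longlonglongrightarrow> g x" .
        qed
        show "AE x in lborel. norm (indicat_real {x. norm x > E n} x *\<^sub>R g x) \<le> norm (g x)" for n
          by (rule AE_I2) (auto simp: indicator_def)
        show "(\<lambda>x. indicat_real {x. norm x > E n} x *\<^sub>R g x) \<in> borel_measurable lborel" for n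
          using setg[of "E n"] unfolding set_integrable_def by auto
      qed auto
      thus "(\<lambda>n. hardy_truncated u (E n)) \<longlonglongrightarrow> (LINT x|lborel. g x)"
        using trunc[OF E(1)] by simp
    qed simp
    thus ?thesis using False setH cong unfolding has_hardy_value_def by simp
  qed
qed

text \<open>Integrating the density identity. The function \<open>k\<close> whose radial derivative is integrated against the
  kernel is \<open>flux a (|x|\<^sup>2) v\<^sup>2\<close>, with value \<open>a v(0)\<^sup>2\<close> at the origin; so the
  constant is \<open>a\<close> times the area of the unit sphere.\<close>

lemma hardy_value_bessel_profile:
  assumes N: "CARD('n::finite) \<ge> 3" and a: "a = (real CARD('n) - 2) / 2"
  shows "\<exists>A\<ge>0. \<forall>(v :: real ^ 'n \<Rightarrow> real) G. C1_compact v G \<longrightarrow>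
       integrable lborel (\<lambda>x. (bessel_profile a v x)\<^sup>2)
       \<and> has_hardy_value (bessel_profile a v)
          ((LINT x|lborel. bessel_weight x * (norm (G x))\<^sup>2) + sq_integral (bessel_profile a v) + A * (v 0)\<^sup>2)"
proof -
  have a': "a = (real DIM(real ^ 'n) - 2) / 2" using a by simp
  have a0: "a \<ge> 0" using N a by simp
  obtain A :: real where A: "A \<ge> 0"
    "\<And>(k :: real ^ 'n \<Rightarrow> real) K. C1_compact k K \<Longrightarrow>
       (LINT x|lborel. x \<bullet> K x / norm x ^ DIM(real ^ 'n)) = - A * k 0"
    using integral_radial_derivative_kernel by metis
  have "integrable lborel (\<lambda>x. (bessel_profile a v x)\<^sup>2)
       \<and> has_hardy_value (bessel_profile a v)
          ((LINT x|lborel. bessel_weight x * (norm (G x))\<^sup>2) + sq_integral (bessel_profile a v) + (A * a) * (v 0)\<^sup>2)"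
    if v: "C1_compact v G" for v :: "real ^ 'n \<Rightarrow> real" and G
  proof -
    let ?u = "bessel_profile a v"
    note cont = C1_compact_continuous[OF v]
    obtain B where B: "\<And>x. norm x \<ge> B \<Longrightarrow> v x = 0" "\<And>x. norm x \<ge> B \<Longrightarrow> G x = 0"
      using C1_compact_support[OF v] by metis
    have u2: "integrable lborel (\<lambda>x. (?u x)\<^sup>2)"
      unfolding bessel_profile_square[OF a']
      by (rule integrable_bessel_weight[of _ B]) (auto intro!: continuous_intros cont simp: B)
    have E: "integrable lborel (\<lambda>x. bessel_weight x * (norm (G x))\<^sup>2)"
      by (rule integrable_bessel_weight[of _ B]) (auto intro!: continuous_intros cont simp: B)
    let ?K = "\<lambda>x. (2 * flux' a ((norm x)\<^sup>2) * (v x)\<^sup>2) *\<^sub>R x + (2 * flux a ((norm x)\<^sup>2) * v x) *\<^sub>R G x"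
    have K: "C1_compact (\<lambda>x. flux a ((norm x)\<^sup>2) * (v x)\<^sup>2) ?K"
      by (rule C1_compact_radial_times_square[OF v DERIV_flux continuous_flux'])
    note intK = integrable_radial_derivative_kernel[OF K]
    let ?g = "\<lambda>x. bessel_weight x * (norm (G x))\<^sup>2 + (?u x)\<^sup>2 - x \<bullet> ?K x / norm x ^ DIM(real ^ 'n)"
    have [measurable]: "v \<in> borel_measurable borel" using cont(1) by (rule borel_measurable_continuous_onI)
    have meas: "?u \<in> borel_measurable borel"
      unfolding bessel_profile_def[abs_def] bessel_J0_eq_bess by measurable
    have intg: "integrable lborel ?g" using E u2 intK by simp
    have der: "GDERIV v x :> G x" for x using v by (simp add: C1_compact_def)
    have "has_hardy_value ?u (LINT x|lborel. ?g x)"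
    proof (rule has_hardy_value_if_regular_difference[OF N meas u2 intg])
      fix x :: "real ^ 'n" assume "x \<noteq> 0"
      from hardy_density_identity[OF this der a']
      show "(norm (grad ?u x))\<^sup>2 = ?g x + hardy_const TYPE('n) * ((?u x)\<^sup>2 / (norm x)\<^sup>2)"
        by (simp add: hardy_const_def a)
    qed
    also have "(LINT x|lborel. ?g x) = (LINT x|lborel. bessel_weight x * (norm (G x))\<^sup>2) + sq_integral ?u
        - (LINT x|lborel. x \<bullet> ?K x / norm x ^ DIM(real ^ 'n))"
      unfolding sq_integral_def
      using Bochner_Integration.integral_diff[OF Bochner_Integration.integrable_add[OF E u2] intK]
        Bochner_Integration.integral_add[OF E u2] by simp
    also have "(LINT x|lborel. x \<bullet> ?K x / norm x ^ DIM(real ^ 'n)) = - (A * a) * (v 0)\<^sup>2"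
      by (subst A(2)[OF K]) (simp add: flux_def bess_0)
    finally show ?thesis using u2 by simp
  qed
  thus ?thesis using A(1) a0 by (intro exI[of _ "A * a"]) simp
qed

section \<open>Smooth cut-off functions\<close>

text \<open>The functions \<open>p(1 / t) exp(- 1 / t)\<close> with \<open>p\<close> a polynomial, extended by \<open>0\<close> to \<open>t \<le> 0\<close>. This family is closed under
  differentiation, so smoothness can be proved for all of its members by one induction.\<close>

definition flat :: "real poly \<Rightarrow> real \<Rightarrow> real" where
  "flat p t = (if t > 0 then poly p (1 / t) * exp (- (1 / t)) else 0)"

lemma poly_times_exp_minus_tendsto_0:
  fixes p :: "real poly"
  shows "((\<lambda>s. poly p s * exp (- s)) \<longlongrightarrow> 0) at_top"
proof -
  have "((\<lambda>s. \<Sum>i\<le>degree p. coeff p i * (s ^ i / exp s)) \<longlongrightarrow> (\<Sum>i\<le>degree p. coeff p i * 0)) at_top"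
    by (intro tendsto_sum tendsto_mult tendsto_const tendsto_power_div_exp_0)
  moreover have "(\<Sum>i\<le>degree p. coeff p i * (s ^ i / exp s)) = poly p s * exp (- s)" for s
    by (simp add: poly_altdef exp_minus sum_distrib_right divide_inverse mult.assoc)
  ultimately show ?thesis by simp
qed

text \<open>At the origin the right-hand difference quotient \<open>p(1 / h) exp(- 1 / h) / h\<close> is a member of the family
  again, with polynomial \<open>X p\<close>, and tends to \<open>0\<close> because the exponential dominates.\<close>

lemma DERIV_flat: "(flat p has_real_derivative flat ([:0, 0, 1:] * (p - pderiv p)) t) (at t)"
proof -
  consider "t > 0" | "t < 0" | "t = 0" by linarith
  thus ?thesis
  proof cases
    case 1
    have "((\<lambda>t. poly p (1 / t) * exp (- (1 / t))) has_real_derivative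
        flat ([:0, 0, 1:] * (p - pderiv p)) t) (at t)"
      using 1 by (auto intro!: derivative_eq_intros DERIV_chain2[OF poly_DERIV]
          simp: flat_def power2_eq_square field_simps)
    thus ?thesis
      by (rule has_field_derivative_transform_within_open[of _ _ _ "{0<..}"]) (use 1 in \<open>auto simp: flat_def\<close>)
  next
    case 2
    have "((\<lambda>t. 0) has_real_derivative flat ([:0, 0, 1:] * (p - pderiv p)) t) (at t)"
      using 2 by (simp add: flat_def)
    thus ?thesis
      by (rule has_field_derivative_transform_within_open[of _ _ _ "{..<0}"]) (use 2 in \<open>auto simp: flat_def\<close>)
  next
    case 3
    have "((\<lambda>h. flat p h / h) \<longlongrightarrow> 0) (at_right 0)"
    proof (rule Lim_transform_eventually)
      show "((\<lambda>h. poly (pCons 0 p) (inverse h) * exp (- inverse h)) \<longlongrightarrow> 0) (at_right (0::real))"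
        by (rule filterlim_compose[OF poly_times_exp_minus_tendsto_0 filterlim_inverse_at_top_right])
      show "\<forall>\<^sub>F h in at_right 0. poly (pCons 0 p) (inverse h) * exp (- inverse h) = flat p h / h"
        using eventually_at_right_less[of 0] by eventually_elim (simp add: flat_def field_simps)
    qed
    moreover have "((\<lambda>h. flat p h / h) \<longlongrightarrow> 0) (at_left 0)"
    proof (rule Lim_transform_eventually[OF tendsto_const])
      show "\<forall>\<^sub>F h in at_left 0. 0 = flat p h / h"
        by (auto simp: eventually_at_filter flat_def)
    qed
    ultimately have "((\<lambda>h. flat p h / h) \<longlongrightarrow> 0) (at 0)" by (simp add: filterlim_split_at)
    thus ?thesis using 3 by (simp add: has_field_derivative_iff flat_def)
  qed
qed

lemma continuous_on_flat [continuous_intros]: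
  "continuous_on S f \<Longrightarrow> continuous_on S (\<lambda>x. flat p (f x))"
  by (rule continuous_on_compose2[of UNIV "flat p"])
     (auto intro: DERIV_continuous_on has_field_derivative_at_within DERIV_flat)

lemma times_cont_diff_SucI:
  assumes "\<And>x. (f has_derivative D x) (at x)" "\<And>h. times_cont_diff k (\<lambda>x. D x h)"
  shows "times_cont_diff (Suc k) f"
proof -
  have "frechet_derivative f (at x) = D x" for x
    using frechet_derivative_at[OF assms(1)] by simp
  thus ?thesis using assms by (auto simp: differentiable_def)
qed

lemma times_cont_diff_SucD: "times_cont_diff (Suc k) f \<Longrightarrow> times_cont_diff k f"
proof (induction k arbitrary: f)
  case 0
  thus ?case
    by (auto intro!: continuous_at_imp_continuous_on differentiable_imp_continuous_within)
next
  case (Suc k)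
  show ?case
    using Suc.prems Suc.IH by (subst times_cont_diff.simps(2)) auto
qed

lemma times_cont_diff_has_derivative:
  "times_cont_diff (Suc k) f \<Longrightarrow> (f has_derivative frechet_derivative f (at x)) (at x)"
  by (simp add: frechet_derivative_works)

lemma times_cont_diff_const: "times_cont_diff k (\<lambda>_. c)"
proof (induction k arbitrary: c)
  case (Suc k)
  show ?case by (rule times_cont_diff_SucI[where D = "\<lambda>_ _. 0"]) (auto intro: Suc.IH)
qed auto

lemma times_cont_diff_bounded_linear:
  assumes "bounded_linear f" shows "times_cont_diff k f"
proof (cases k)
  case 0
  thus ?thesis using assms by (simp add: linear_continuous_on)
next
  case (Suc m)
  show ?thesis unfolding Suc
    by (rule times_cont_diff_SucI[OF bounded_linear_imp_has_derivative[OF assms] times_cont_diff_const])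
qed

lemma times_cont_diff_add:
  "times_cont_diff k f \<Longrightarrow> times_cont_diff k g \<Longrightarrow> times_cont_diff k (\<lambda>x. f x + g x)"
proof (induction k arbitrary: f g)
  case (Suc k)
  show ?case
    by (rule times_cont_diff_SucI[OF has_derivative_add[OF
          times_cont_diff_has_derivative[OF Suc.prems(1)] times_cont_diff_has_derivative[OF Suc.prems(2)]]])
       (use Suc in auto)
qed (auto intro: continuous_intros)

lemma times_cont_diff_mult:
  "times_cont_diff k f \<Longrightarrow> times_cont_diff k g \<Longrightarrow> times_cont_diff k (\<lambda>x. f x * g x)"
proof (induction k arbitrary: f g)
  case (Suc k)
  have fg: "times_cont_diff k f" "times_cont_diff k g"
    using Suc.prems by (auto intro: times_cont_diff_SucD simp del: times_cont_diff.simps)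
  show ?case
    by (rule times_cont_diff_SucI[OF has_derivative_mult[OF
          times_cont_diff_has_derivative[OF Suc.prems(1)] times_cont_diff_has_derivative[OF Suc.prems(2)]]])
       (use Suc fg in \<open>auto intro!: times_cont_diff_add\<close>)
qed (auto intro: continuous_intros)

text \<open>The order of differentiability is proved for all polynomials \<open>p\<close> at once, since differentiating
  replaces \<open>p\<close> by another polynomial.\<close>

lemma times_cont_diff_flat_compose:
  assumes q: "\<And>x. (q has_derivative D x) (at x)" and D: "\<And>h k. times_cont_diff k (\<lambda>x. D x h)"
  shows "times_cont_diff k (\<lambda>x. flat p (q x))"
proof (induction k arbitrary: p)
  case 0
  have "continuous_on UNIV q"
    using q has_derivative_continuous continuous_at_imp_continuous_on by metis
  thus ?case by (simp add: continuous_on_flat)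
next
  case (Suc k)
  have "((\<lambda>x. flat p (q x)) has_derivative (\<lambda>h. flat ([:0, 0, 1:] * (p - pderiv p)) (q x) * D x h)) (at x)" for x
    using has_derivative_compose[OF q DERIV_flat[unfolded has_field_derivative_def]] .
  thus ?case by (rule times_cont_diff_SucI) (intro times_cont_diff_mult Suc.IH D)
qed

lemma test_function_C1_compact:
  fixes v :: "'a::euclidean_space \<Rightarrow> real"
  assumes "v \<in> test_functions"
  obtains G where "C1_compact v G"
proof -
  define G where "G x = (\<Sum>b\<in>Basis. frechet_derivative v (at x) b *\<^sub>R b)" for x
  have 1: "times_cont_diff (Suc 0) v" using assms by (simp add: test_functions_def del: times_cont_diff.simps)
  have d: "(v has_derivative frechet_derivative v (at x)) (at x)" for x
    by (rule times_cont_diff_has_derivative[OF 1])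
  have "GDERIV v x :> G x" for x
  proof -
    have lin: "linear (frechet_derivative v (at x))"
      using d by (rule has_derivative_linear)
    have "frechet_derivative v (at x) h = h \<bullet> G x" for h
    proof -
      have "frechet_derivative v (at x) h = frechet_derivative v (at x) (\<Sum>b\<in>Basis. (h \<bullet> b) *\<^sub>R b)"
        by (simp add: euclidean_representation)
      also have "\<dots> = (\<Sum>b\<in>Basis. (h \<bullet> b) * frechet_derivative v (at x) b)"
        by (simp add: linear_sum[OF lin] linear_scale[OF lin])
      also have "\<dots> = h \<bullet> G x" by (simp add: G_def inner_sum_right mult.commute)
      finally show ?thesis .
    qed
    hence "frechet_derivative v (at x) = (\<lambda>h. h \<bullet> G x)" by blast
    thus ?thesis using d[of x] by (simp add: gderiv_def)
  qed
  moreover have "continuous_on UNIV G"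
    unfolding G_def using 1 by (intro continuous_intros) simp
  moreover have "\<exists>B. \<forall>x. norm x \<ge> B \<longrightarrow> v x = 0"
  proof -
    have "bounded (closure {x. v x \<noteq> 0})"
      using assms by (simp add: test_functions_def compact_imp_bounded)
    hence "bounded {x. v x \<noteq> 0}" using bounded_subset closure_subset by blast
    then obtain B where "\<And>x. v x \<noteq> 0 \<Longrightarrow> norm x \<le> B" by (auto simp: bounded_iff)
    thus ?thesis by (intro exI[of _ "B + 1"]) force
  qed
  ultimately show ?thesis using that unfolding C1_compact_def by blast
qed

text \<open>The constant \<open>4\<close> puts the boundary of the support at radius \<open>2 R\<close>, so that the profile is strictly
  decreasing on \<open>R < |x| < 2 R\<close>; this is where the lower bound of the mass comes from.\<close>

definition bump :: "real \<Rightarrow> 'a::euclidean_space \<Rightarrow> real" where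
  "bump R x = flat 1 (4 - (norm (x /\<^sub>R R))\<^sup>2)"

definition bump_grad :: "real \<Rightarrow> 'a::euclidean_space \<Rightarrow> 'a" where
  "bump_grad R x = (- 2 / R * flat [:0, 0, 1:] (4 - (norm (x /\<^sub>R R))\<^sup>2)) *\<^sub>R (x /\<^sub>R R)"

lemma has_derivative_bump_arg:
  assumes "R > 0"
  shows "((\<lambda>x::'a::euclidean_space. 4 - (norm (x /\<^sub>R R))\<^sup>2) has_derivative (\<lambda>h. (- 2 / R\<^sup>2) * (h \<bullet> x))) (at x)"
  unfolding power2_norm_eq_inner using assms
  by (auto intro!: derivative_eq_intros simp: fun_eq_iff inner_commute power2_eq_square field_simps)

lemma bump_outside: "R > 0 \<Longrightarrow> norm x \<ge> 2 * R \<Longrightarrow> bump R x = 0"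
proof -
  assume R: "R > 0" "norm x \<ge> 2 * R"
  hence "2 \<le> norm (x /\<^sub>R R)" by (simp add: field_simps)
  from power_mono[OF this, of 2] show ?thesis by (simp add: bump_def flat_def)
qed

lemma C1_compact_bump:
  assumes "R > 0" shows "C1_compact (bump R) (bump_grad R)"
proof -
  have "GDERIV (bump R) x :> bump_grad R x" for x :: 'a
  proof -
    have "((\<lambda>x. flat 1 (4 - (norm (x /\<^sub>R R))\<^sup>2)) has_derivative
       (\<lambda>h. flat ([:0, 0, 1:] * (1 - pderiv 1)) (4 - (norm (x /\<^sub>R R))\<^sup>2) * ((- 2 / R\<^sup>2) * (h \<bullet> x)))) (at x)"
      by (rule has_derivative_compose[OF has_derivative_bump_arg[OF assms] DERIV_flat[unfolded has_field_derivative_def]])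
    moreover have "(\<lambda>h. flat ([:0, 0, 1:] * (1 - pderiv 1)) (4 - (norm (x /\<^sub>R R))\<^sup>2) * ((- 2 / R\<^sup>2) * (h \<bullet> x)))
      = (\<lambda>h. h \<bullet> bump_grad R x)"
      using assms by (auto simp: fun_eq_iff bump_grad_def power2_eq_square pderiv_1 field_simps)
    ultimately show ?thesis unfolding gderiv_def bump_def[abs_def] by simp
  qed
  moreover have "continuous_on UNIV (bump_grad R :: 'a \<Rightarrow> 'a)"
    unfolding bump_grad_def[abs_def] by (intro continuous_intros)
  ultimately show ?thesis using bump_outside[OF assms] unfolding C1_compact_def by blast
qed

lemma bump_test_function:
  assumes "R > 0" shows "(bump R :: 'a::euclidean_space \<Rightarrow> real) \<in> test_functions"
proof -
  have "times_cont_diff k (bump R :: 'a \<Rightarrow> real)" for k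
    unfolding bump_def[abs_def]
  proof (rule times_cont_diff_flat_compose[OF has_derivative_bump_arg[OF assms]])
    show "times_cont_diff k (\<lambda>x::'a. - 2 / R\<^sup>2 * (h \<bullet> x))" for h k
      by (intro times_cont_diff_mult times_cont_diff_const times_cont_diff_bounded_linear bounded_linear_inner_right)
  qed
  moreover have "{x::'a. bump R x \<noteq> 0} \<subseteq> cball 0 (2 * R)"
    using bump_outside[OF assms] by (metis (mono_tags, lifting) mem_Collect_eq mem_cball_0 nle_le subsetI)
  hence "bounded {x::'a. bump R x \<noteq> 0}" using bounded_cball bounded_subset by blast
  hence "compact (closure {x::'a. bump R x \<noteq> 0})" by simp
  ultimately show ?thesis by (simp add: test_functions_def)
qed

section \<open>Strictness, the best constant and the missing minimizer\<close>

lemma bump_grad_scale: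
  assumes "R > 0" shows "bump_grad R (R *\<^sub>R y) = bump_grad 1 y /\<^sub>R R"
  using assms by (simp add: bump_grad_def field_simps)

lemma bump_scale:
  assumes "R > 0" shows "bump R (R *\<^sub>R y) = bump 1 y"
  using assms by (simp add: bump_def)

text \<open>Since \<open>|J\<^sub>0| \<le> 1\<close>, the weight is at most \<open>|x|\<^sup>2\<^sup>-\<^sup>N\<close>. The integral of \<open>|x|\<^sup>2\<^sup>-\<^sup>N |\<nabla>v|\<^sup>2\<close> is invariant
  under dilations of \<open>v\<close>, as the Dirichlet integral in the plane is.\<close>

lemma bump_energy_bounded:
  obtains M where "\<And>R. R > 0 \<Longrightarrow>
    (LINT x|lborel. bessel_weight (x::'a::euclidean_space) * (norm (bump_grad R x))\<^sup>2) \<le> M"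
proof
  fix R :: real assume R: "R > 0"
  let ?w = "\<lambda>x::'a. (norm x)\<^sup>2 / norm x ^ DIM('a)"
  let ?f = "\<lambda>x::'a. ?w x * (norm (bump_grad R x))\<^sup>2"
  note b = C1_compact_bump[OF R, where 'a='a]
  note cont = C1_compact_continuous[OF b]
  obtain B where B: "\<And>x::'a. norm x \<ge> B \<Longrightarrow> bump_grad R x = 0"
    using C1_compact_support[OF b] by metis
  have int: "integrable lborel ?f"
    by (rule integrable_dominated_weight[of _ B]) (auto intro!: continuous_intros cont simp: B)
  have intb: "integrable lborel (\<lambda>x::'a. bessel_weight x * (norm (bump_grad R x))\<^sup>2)"
    by (rule integrable_bessel_weight[of _ B]) (auto intro!: continuous_intros cont simp: B)
  have "(LINT x|lborel. bessel_weight (x::'a) * (norm (bump_grad R x))\<^sup>2) \<le> (LINT x|lborel. ?f x)"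
    by (rule integral_mono[OF intb int]) (simp add: mult_right_mono bessel_weight_le del: times_divide_eq_left)
  also have "\<dots> = R ^ DIM('a) * (LINT y|lborel. ?f (R *\<^sub>R y))"
    using integral_lborel_scale(2)[OF int R] R by simp
  also have "\<dots> = (LINT y|lborel. R ^ DIM('a) * ?f (R *\<^sub>R y))"
    by (rule integral_mult_right_zero[symmetric])
  also have "\<dots> = (LINT y|lborel. ?w (y::'a) * (norm (bump_grad 1 y))\<^sup>2)"
    using R by (intro Bochner_Integration.integral_cong refl)
      (simp add: bump_grad_scale power_mult_distrib power_inverse field_simps)
  finally show "(LINT x|lborel. bessel_weight (x::'a) * (norm (bump_grad R x))\<^sup>2)
    \<le> (LINT y|lborel. ?w (y::'a) * (norm (bump_grad 1 y))\<^sup>2)" .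
qed

lemma flat_pos: "t > 0 \<Longrightarrow> flat 1 t > 0" "t > 0 \<Longrightarrow> flat [:0, 0, 1:] t > 0"
  by (auto simp: flat_def)

lemma flat_nonneg: "flat 1 t \<ge> 0" "flat [:0, 0, 1:] t \<ge> 0"
  by (auto simp: flat_def)

text \<open>The weight is half the divergence of \<open>p(|x|\<^sup>2) x / |x|\<^sup>N\<close>, where \<open>p\<close> is \<open>pohozaev\<close>. Moving the derivative to the cut-off
  \<open>v = bump R\<close> turns the integral of weight times \<open>v\<^sup>2\<close> into that of \<open>- p(|x|\<^sup>2) v (x \<bullet> \<nabla>v) / |x|\<^sup>N\<close>; there is no
  contribution from the origin because \<open>p(0) = 0\<close>. In the variable \<open>y = x / R\<close> this is the integral of
  \<open>p(R\<^sup>2 |y|\<^sup>2) \<psi>(y)\<close> with a nonnegative \<open>\<psi>\<close> that does not depend on \<open>R\<close>. By monotonicity of \<open>p\<close> the part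
  \<open>|y| \<ge> 1\<close> contributes at least \<open>p(R\<^sup>2)\<close> times the integral of \<open>\<psi>\<close> over it, which is \<open>m\<close>.\<close>

lemma bump_mass_lower_bound:
  obtains m where "m > 0" "\<And>R. R > 0 \<Longrightarrow>
    m * pohozaev (R\<^sup>2) \<le> (LINT x|lborel. bessel_weight (x::'a::euclidean_space) * (bump R x)\<^sup>2)"
proof -
  define \<psi> :: "'a \<Rightarrow> real" where
    "\<psi> y = - (bump 1 y * (y \<bullet> bump_grad 1 y) / norm y ^ DIM('a))" for y
  have \<psi>_eq: "\<psi> y = 2 * flat 1 (4 - (norm y)\<^sup>2) * flat [:0, 0, 1:] (4 - (norm y)\<^sup>2)
      * (norm y)\<^sup>2 / norm y ^ DIM('a)" for y
    by (simp add: \<psi>_def bump_def bump_grad_def power2_norm_eq_inner)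
  have \<psi>_nonneg: "\<psi> y \<ge> 0" for y
    unfolding \<psi>_eq by (intro divide_nonneg_nonneg mult_nonneg_nonneg flat_nonneg) auto
  have \<psi>_int: "integrable lborel \<psi>"
  proof -
    have "C1_compact (\<lambda>x::'a. (1::real) * (bump 1 x)\<^sup>2)
      (\<lambda>x. (2 * 0 * (bump 1 x)\<^sup>2) *\<^sub>R x + (2 * 1 * bump 1 x) *\<^sub>R bump_grad 1 x)"
      by (rule C1_compact_radial_times_square[OF C1_compact_bump, where F = "\<lambda>_. 1" and F' = "\<lambda>_. 0"]) auto
    from integrable_mult_right[OF integrable_radial_derivative_kernel[OF this], of "- (1 / 2)"]
    show ?thesis unfolding \<psi>_def[abs_def] by simp
  qed
  let ?S = "{y::'a. norm y \<ge> 1}"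
  have S: "?S \<in> sets lborel" by measurable
  have int_S: "integrable lborel (\<lambda>y. indicator ?S y * \<psi> y)"
    using integrable_mult_indicator[OF S \<psi>_int] by simp
  define m where "m = (LINT y|lborel. indicator ?S y * \<psi> y)"
  have "m \<noteq> 0"
  proof
    assume "m = 0"
    hence ae: "AE y in lborel. indicator ?S y * \<psi> y = 0"
      unfolding m_def by (subst (asm) integral_nonneg_eq_0_iff_AE) (use int_S \<psi>_nonneg in auto)
    obtain e :: 'a where e: "e \<in> Basis" using nonempty_Basis by blast
    let ?V = "{y::'a. 1 < norm y} \<inter> {y. norm y < 2}"
    have "(3 / 2) *\<^sub>R e \<in> ?V" using e by simp
    hence "?V \<noteq> {}" by blast
    moreover have "open ?V" by (intro open_Int open_Collect_less continuous_intros)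
    ultimately have "\<exists>y\<in>?V. indicator ?S y * \<psi> y = 0" by (intro AE_lborel_open[OF ae])
    then obtain y :: 'a where y: "1 < norm y" "norm y < 2" "indicator ?S y * \<psi> y = 0" by auto
    have "4 - (norm y)\<^sup>2 > 0" using power_strict_mono[OF y(2), of 2] by simp
    moreover have "norm y > 0" using y(1) by linarith
    hence "norm y ^ DIM('a) > 0" "(norm y)\<^sup>2 > 0" by (rule zero_less_power)+
    ultimately have "\<psi> y > 0" unfolding \<psi>_eq by (auto intro!: divide_pos_pos mult_pos_pos flat_pos)
    thus False using y by simp
  qed
  moreover have "m \<ge> 0" unfolding m_def
    by (intro integral_nonneg_AE AE_I2) (simp add: \<psi>_nonneg)
  ultimately have "m > 0" by simp
  moreover have "m * pohozaev (R\<^sup>2) \<le> (LINT x|lborel. bessel_weight (x::'a) * (bump R x)\<^sup>2)"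
    if R: "R > 0" for R
  proof -
    note b = C1_compact_bump[OF R, where 'a='a]
    note cont = C1_compact_continuous[OF b]
    obtain B where B: "\<And>x::'a. norm x \<ge> B \<Longrightarrow> bump R x = 0"
      using C1_compact_support[OF b] by metis
    have mass: "integrable lborel (\<lambda>x::'a. bessel_weight x * (bump R x)\<^sup>2)"
      by (rule integrable_bessel_weight[of _ B]) (auto intro!: continuous_intros cont simp: B)
    let ?K = "\<lambda>x::'a. (2 * (bess ((norm x)\<^sup>2))\<^sup>2 * (bump R x)\<^sup>2) *\<^sub>R x
        + (2 * pohozaev ((norm x)\<^sup>2) * bump R x) *\<^sub>R bump_grad R x"
    have "continuous_on UNIV (\<lambda>s. (bess s)\<^sup>2)" by (intro continuous_intros)
    from C1_compact_radial_times_square[OF b DERIV_pohozaev this]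
    have K: "C1_compact (\<lambda>x. pohozaev ((norm x)\<^sup>2) * (bump R x)\<^sup>2) ?K" .
    note intK = integrable_radial_derivative_kernel[OF K]
    have zero: "(LINT x|lborel. x \<bullet> ?K x / norm x ^ DIM('a)) = 0"
    proof -
      obtain A :: real where "\<And>(k :: 'a \<Rightarrow> real) K. C1_compact k K \<Longrightarrow>
         (LINT x|lborel. x \<bullet> K x / norm x ^ DIM('a)) = - A * k 0"
        using integral_radial_derivative_kernel by metis
      from this[OF K] show ?thesis by (simp add: pohozaev_def)
    qed
    let ?h = "\<lambda>x::'a. pohozaev ((norm x)\<^sup>2) * (bump R x * (x \<bullet> bump_grad R x)) / norm x ^ DIM('a)"
    \<comment> \<open>the derivative of the factor \<open>p\<close> contributes the weight because \<open>p' = bess\<^sup>2\<close>\<close>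
    have h_eq: "?h x = (x \<bullet> ?K x / norm x ^ DIM('a)) / 2 - bessel_weight x * (bump R x)\<^sup>2" for x
      by (simp add: bessel_weight_def inner_add_right power2_norm_eq_inner[symmetric]
          add_divide_distrib mult_ac)
    have intK2: "integrable lborel (\<lambda>x. (x \<bullet> ?K x / norm x ^ DIM('a)) / 2)"
      by (rule integrable_divide_zero) (rule intK)
    have zero2: "(LINT x|lborel. (x \<bullet> ?K x / norm x ^ DIM('a)) / 2) = 0"
      by (subst integral_divide_zero) (simp only: zero div_0)
    have int_h: "integrable lborel ?h" unfolding h_eq
      by (rule Bochner_Integration.integrable_diff[OF intK2 mass])
    have "(LINT x|lborel. ?h x) = - (LINT x|lborel. bessel_weight (x::'a) * (bump R x)\<^sup>2)"
      unfolding h_eq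
      by (subst Bochner_Integration.integral_diff[OF intK2 mass])
         (simp only: zero2 diff_0)
    moreover have "(LINT x|lborel. ?h x) = R ^ DIM('a) * (LINT y|lborel. ?h (R *\<^sub>R y))"
      using integral_lborel_scale(2)[OF int_h R] R by simp
    ultimately have 1: "(LINT x|lborel. bessel_weight (x::'a) * (bump R x)\<^sup>2)
        = (LINT y|lborel. - (R ^ DIM('a)) * ?h (R *\<^sub>R y))"
      by (subst integral_mult_right_zero) simp
    have h_scale: "- (R ^ DIM('a)) * ?h (R *\<^sub>R y) = pohozaev (R\<^sup>2 * (norm y)\<^sup>2) * \<psi> y" for y
      using R by (simp add: bump_scale bump_grad_scale \<psi>_def power_mult_distrib)
    have "integrable lborel (\<lambda>y. - (R ^ DIM('a)) * ?h (R *\<^sub>R y))"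
      by (rule integrable_mult_right[OF integral_lborel_scale(1)[OF int_h R]])
    hence 2: "integrable lborel (\<lambda>y. pohozaev (R\<^sup>2 * (norm y)\<^sup>2) * \<psi> y)" unfolding h_scale .
    have "m * pohozaev (R\<^sup>2) = (LINT y|lborel. pohozaev (R\<^sup>2) * (indicator ?S y * \<psi> y))"
      unfolding m_def by (simp only: integral_mult_right_zero mult.commute)
    also have "\<dots> \<le> (LINT y|lborel. pohozaev (R\<^sup>2 * (norm y)\<^sup>2) * \<psi> y)"
    proof (rule integral_mono[OF integrable_mult_right[OF int_S] 2])
      fix y :: 'a
      show "pohozaev (R\<^sup>2) * (indicator ?S y * \<psi> y) \<le> pohozaev (R\<^sup>2 * (norm y)\<^sup>2) * \<psi> y"
      proof (cases "norm y \<ge> 1")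
        case True
        have "R\<^sup>2 * 1\<^sup>2 \<le> R\<^sup>2 * (norm y)\<^sup>2" using True by (intro mult_left_mono power_mono) auto
        thus ?thesis using True \<psi>_nonneg by (auto intro!: mult_right_mono pohozaev_mono)
      next
        case False
        have "pohozaev (R\<^sup>2 * (norm y)\<^sup>2) \<ge> 0" by (simp add: pohozaev_def)
        thus ?thesis using False \<psi>_nonneg by simp
      qed
    qed
    also have "\<dots> = (LINT x|lborel. bessel_weight (x::'a) * (bump R x)\<^sup>2)"
      unfolding 1 h_scale ..
    finally show ?thesis .
  qed
  ultimately show ?thesis using that by blast
qed

lemma C1_compact_grad_nonzero:
  assumes v: "C1_compact v G" and nz: "v \<noteq> (\<lambda>_. 0)"
  obtains x where "G x \<noteq> 0"
proof (rule ccontr)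
  assume "\<not> thesis"
  hence G0: "G x = 0" for x using that by blast
  have "(v has_derivative (\<lambda>h. 0)) (at x within UNIV)" for x
    using v G0 by (auto simp: C1_compact_def gderiv_def)
  then obtain c where c: "\<And>x. v x = c"
    using has_derivative_zero_constant[of UNIV v] by auto
  obtain B where B: "B > 0" "\<And>x. norm x \<ge> B \<Longrightarrow> v x = 0" using C1_compact_support[OF v] by metis
  obtain e :: 'a where "e \<in> Basis" using nonempty_Basis by blast
  hence "v (B *\<^sub>R e) = 0" using B by simp
  hence "v = (\<lambda>_. 0)" using c by auto
  thus False using nz by contradiction
qed

lemma admissible_eq:
  "(admissible :: (real ^ 'n \<Rightarrow> real) set) =
    {bessel_profile ((real CARD('n) - 2) / 2) v | v. v \<in> test_functions \<and> v \<noteq> (\<lambda>_. 0)}"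
  unfolding admissible_def bessel_profile_def[abs_def] by simp

lemma admissible_hardy:
  fixes u :: "real ^ 'n \<Rightarrow> real"
  assumes N: "CARD('n) \<ge> 3" and u: "u \<in> admissible"
  shows "integrable lborel (\<lambda>x. (u x)\<^sup>2)" "\<exists>L. has_hardy_value u L"
    "hardy_functional u > sq_integral u" "sq_integral u > 0"
proof -
  define a where "a = (real CARD('n) - 2) / 2"
  have a': "a = (real DIM(real ^ 'n) - 2) / 2" by (simp add: a_def)
  obtain v where v: "u = bessel_profile a v" "v \<in> test_functions" "v \<noteq> (\<lambda>_. 0)"
    using u unfolding admissible_eq a_def by blast
  obtain G where G: "C1_compact v G" using test_function_C1_compact[OF v(2)] by metis
  note cont = C1_compact_continuous[OF G]
  obtain B where B: "\<And>x. norm x \<ge> B \<Longrightarrow> v x = 0" "\<And>x. norm x \<ge> B \<Longrightarrow> G x = 0"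
    using C1_compact_support[OF G] by metis
  obtain A where A0: "A \<ge> 0"
    and all: "\<forall>(v :: real ^ 'n \<Rightarrow> real) G. C1_compact v G \<longrightarrow>
       integrable lborel (\<lambda>x. (bessel_profile a v x)\<^sup>2)
       \<and> has_hardy_value (bessel_profile a v)
          ((LINT x|lborel. bessel_weight x * (norm (G x))\<^sup>2) + sq_integral (bessel_profile a v) + A * (v 0)\<^sup>2)"
    using hardy_value_bessel_profile[OF N a_def] by auto
  note A = A0 all[rule_format, OF G, folded v(1), THEN conjunct1] all[rule_format, OF G, folded v(1), THEN conjunct2]
  show "integrable lborel (\<lambda>x. (u x)\<^sup>2)" "\<exists>L. has_hardy_value u L" using A by blast+
  obtain x0 where "G x0 \<noteq> 0" using C1_compact_grad_nonzero[OF G v(3)] by metis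
  hence "(LINT x|lborel. bessel_weight x * (norm (G x))\<^sup>2) > 0"
    by (intro integral_bessel_weight_pos[where B = B and ?x0.0 = x0]) (auto intro!: continuous_intros cont simp: B)
  moreover have "A * (v 0)\<^sup>2 \<ge> 0" using A(1) by simp
  ultimately show "hardy_functional u > sq_integral u"
    unfolding hardy_functional_eqI[OF A(3)] by linarith
  obtain x1 where "v x1 \<noteq> 0" using v(3) by auto
  thus "sq_integral u > 0"
    unfolding sq_integral_def v(1) bessel_profile_square[OF a']
    by (intro integral_bessel_weight_pos[where B = B and ?x0.0 = x1]) (auto intro!: continuous_intros cont simp: B)
qed

text \<open>For \<open>v = bump R\<close> the excess of the Hardy functional over \<open>\<integral> u\<^sup>2\<close> is at most a constant \<open>T\<close>, uniformly in \<open>R\<close>,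
  while \<open>\<integral> u\<^sup>2\<close> is at least \<open>m p(R\<^sup>2)\<close>. So it suffices to choose \<open>s = R\<^sup>2\<close> with \<open>p(s) > T / (\<epsilon> m)\<close>.\<close>

lemma admissible_near_equality:
  assumes N: "CARD('n::finite) \<ge> 3" and \<epsilon>: "\<epsilon> > 0"
  obtains u :: "real ^ 'n \<Rightarrow> real" where "u \<in> admissible" "hardy_functional u < (1 + \<epsilon>) * sq_integral u"
proof -
  define a where "a = (real CARD('n) - 2) / 2"
  have a': "a = (real DIM(real ^ 'n) - 2) / 2" by (simp add: a_def)
  obtain A where A0: "A \<ge> 0"
    and all: "\<forall>(v :: real ^ 'n \<Rightarrow> real) G. C1_compact v G \<longrightarrow>
       integrable lborel (\<lambda>x. (bessel_profile a v x)\<^sup>2)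
       \<and> has_hardy_value (bessel_profile a v)
          ((LINT x|lborel. bessel_weight x * (norm (G x))\<^sup>2) + sq_integral (bessel_profile a v) + A * (v 0)\<^sup>2)"
    using hardy_value_bessel_profile[OF N a_def] by auto
  obtain M where M: "\<And>R. R > 0 \<Longrightarrow>
      (LINT x|lborel. bessel_weight (x::real ^ 'n) * (norm (bump_grad R x))\<^sup>2) \<le> M"
    using bump_energy_bounded by metis
  obtain m where m: "m > 0" "\<And>R. R > 0 \<Longrightarrow>
      m * pohozaev (R\<^sup>2) \<le> (LINT x|lborel. bessel_weight (x::real ^ 'n) * (bump R x)\<^sup>2)"
    using bump_mass_lower_bound by metis
  define T where "T = M + A * (flat 1 4)\<^sup>2"
  have "\<forall>\<^sub>F s in at_top. T / (\<epsilon> * m) < pohozaev s"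
    using pohozaev_at_top by (simp add: filterlim_at_top_dense)
  hence "\<forall>\<^sub>F s in at_top. T / (\<epsilon> * m) < pohozaev s \<and> s > 0"
    using eventually_gt_at_top[of "0::real"] by eventually_elim simp
  then obtain s where s: "T / (\<epsilon> * m) < pohozaev s" "s > 0"
    using eventually_happens[of _ at_top] by force
  define R where "R = sqrt s"
  have R: "R > 0" "R\<^sup>2 = s" using s by (auto simp: R_def)
  let ?v = "bump R :: real ^ 'n \<Rightarrow> real"
  let ?u = "bessel_profile a ?v"
  have v0: "?v 0 = flat 1 4" by (simp add: bump_def)
  have "T < \<epsilon> * (m * pohozaev s)" using s(1) \<epsilon> m(1) by (simp add: field_simps)
  also have "\<dots> \<le> \<epsilon> * sq_integral ?u"
    using m(2)[OF R(1)] \<epsilon> unfolding sq_integral_def bessel_profile_square[OF a'] R(2)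
    by (intro mult_left_mono) auto
  finally have "T < \<epsilon> * sq_integral ?u" .
  moreover have "hardy_functional ?u \<le> T + sq_integral ?u"
    unfolding hardy_functional_eqI[OF all[rule_format, OF C1_compact_bump[OF R(1)], THEN conjunct2]] v0 T_def
    using M[OF R(1)] by simp
  ultimately have "hardy_functional ?u < (1 + \<epsilon>) * sq_integral ?u" by (simp add: algebra_simps)
  moreover have "?u \<in> admissible"
  proof -
    have "?v 0 \<noteq> 0" unfolding v0 using flat_pos(1)[of 4] by simp
    hence "?v \<noteq> (\<lambda>_. 0)" by metis
    thus ?thesis unfolding admissible_eq a_def using bump_test_function[OF R(1)] by blast
  qed
  ultimately show ?thesis using that by blast
qed

theorem lemma1p1:
  assumes "CARD('n::finite) \<ge> 3"
  shows "(\<forall>u \<in> (admissible :: (real ^ 'n \<Rightarrow> real) set).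
            integrable lborel (\<lambda>x. (u x)\<^sup>2) \<and> (\<exists>L. has_hardy_value u L) \<and>
            hardy_functional u > sq_integral u)
    \<and> (\<forall>C::real. (\<forall>u \<in> (admissible :: (real ^ 'n \<Rightarrow> real) set).
            hardy_functional u > C * sq_integral u) \<longrightarrow> C \<le> 1)
    \<and> (\<nexists>u :: real ^ 'n \<Rightarrow> real.
            is_arg_min (\<lambda>u. hardy_functional u / sq_integral u) (\<lambda>u. u \<in> admissible) u)"
proof (intro conjI ballI allI impI notI)
  fix u :: "real ^ 'n \<Rightarrow> real" assume "u \<in> admissible"
  note h = admissible_hardy[OF assms this]
  show "integrable lborel (\<lambda>x. (u x)\<^sup>2)" "\<exists>L. has_hardy_value u L"
    "sq_integral u < hardy_functional u" by (fact h)+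
next
  fix C :: real
  assume C: "\<forall>u \<in> (admissible :: (real ^ 'n \<Rightarrow> real) set). C * sq_integral u < hardy_functional u"
  show "C \<le> 1"
  proof (rule ccontr)
    assume "\<not> C \<le> 1"
    hence "C - 1 > 0" by simp
    then obtain u :: "real ^ 'n \<Rightarrow> real"
      where "u \<in> admissible" "hardy_functional u < (1 + (C - 1)) * sq_integral u"
      using admissible_near_equality[OF assms] by metis
    with C show False by fastforce
  qed
next
  assume "\<exists>u :: real ^ 'n \<Rightarrow> real.
    is_arg_min (\<lambda>u. hardy_functional u / sq_integral u) (\<lambda>u. u \<in> admissible) u"
  then obtain u :: "real ^ 'n \<Rightarrow> real" where
    arg_min: "is_arg_min (\<lambda>u. hardy_functional u / sq_integral u) (\<lambda>u. u \<in> admissible) u" ..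
  hence u: "u \<in> admissible" by (simp add: is_arg_min_def)
  have min: "\<not> hardy_functional w / sq_integral w < hardy_functional u / sq_integral u"
    if "w \<in> admissible" for w :: "real ^ 'n \<Rightarrow> real"
    using arg_min that by (simp add: is_arg_min_def)
  define \<epsilon> where "\<epsilon> = hardy_functional u / sq_integral u - 1"
  have "\<epsilon> > 0" using admissible_hardy(3,4)[OF assms u] by (simp add: \<epsilon>_def)
  then obtain w :: "real ^ 'n \<Rightarrow> real"
    where w: "w \<in> admissible" "hardy_functional w < (1 + \<epsilon>) * sq_integral w"
    using admissible_near_equality[OF assms] by metis
  have "hardy_functional w / sq_integral w < 1 + \<epsilon>"
    using w(2) admissible_hardy(4)[OF assms w(1)] by (simp add: pos_divide_less_eq)
  thus False using min[OF w(1)] by (simp add: \<epsilon>_def)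
qed

end
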